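(* Let $n\ge3$. The linear operator $T:\mathcal H\to\mathcal M$ defined by the formula $$Te'_{ij}=E_{ij},\qquad 1\le i<j\le n,$$ is a unitary isomorphism of the representations of the symmetric group $\mathfrak S_n$ in the spaces $\mathcal H$ (the restriction of the left regular representation) and $\mathcal M$ (the representation $\varrho$).
   Context: $\mathfrak S_n$ is the symmetric group on $\{1,\dots,n\}$, with products taken left to right: $(\sigma\tau)(i)=\tau(\sigma(i))$. $\mathbb C[\mathfrak S_n]$ carries the standard Hermitian inner product in which the group elements form an orthonormal basis; the left regular representation acts by left multiplication. $\mathcal M$ is the space of complex $n\times n$ skew-symmetric matrices with inner product $\langle A,B\rangle=\sum_{i<j}\overline{a_{ij}}\,b_{ij}$. The representation $\varrho$ of $\mathfrak S_n$ in $\mathcal M$ is by simultaneous permutations of rows and columns: $\varrho(\sigma)(a_{ij})_{i,j}=(a_{\sigma(i)\sigma(j)})_{i,j}$. For $1\le i<j\le n$, $E_{ij}\in\mathcal M$ has $1$ in cell $(i,j)$, $-1$ in cell $(j,i)$, and zeros elsewhere. For $1\le i<j\le n$ let $e_{ij}=\frac1{\sqrt{n!}}\sum_{\sigma\in\mathfrak S_n}\varepsilon_{ij}(\sigma)\sigma$, where $\varepsilon_{ij}(\sigma)=1$ if $\sigma(i)<\sigma(j)$ and $-1$ if $\sigma(i)>\sigma(j)$; $\mathcal H$ is the linear span of the $e_{ij}$ in $\mathbb C[\mathfrak S_n]$; it is invariant under left multiplication. Let $C_1$ and $C_2$ be the (primitive) central idempotents in $\mathbb C[\mathfrak S_n]$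 corresponding to the irreducible representations with Young diagrams $(n-1,1)$ and $(n-2,1^2)$, respectively. Put $$A=\frac{\sqrt3}{\sqrt{n+1}}\bigl(C_1+\sqrt{n+1}\,C_2\bigr),\qquad e'_{ij}=Ae_{ij}.$$ *)

theory Defs
  imports Complex_Main "HOL-Library.Function_Algebras" "HOL-Library.FuncSet"
    "HOL-Combinatorics.Permutations"
begin

section \<open>The group algebra of the symmetric group\<close>

definition Sym :: "nat \<Rightarrow> (nat \<Rightarrow> nat) set" where
  "Sym n = {\<sigma>. \<sigma> permutes {1..n}}"

text \<open>Products of permutations are taken from left to right.\<close>

definition perm_mult :: "(nat \<Rightarrow> nat) \<Rightarrow> (nat \<Rightarrow> nat) \<Rightarrow> nat \<Rightarrow> nat" where
  "perm_mult \<sigma> \<tau> = (\<lambda>i. \<tau> (\<sigma> i))"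

text \<open>An element of the group algebra is its coefficient function, extended by zero to all
  functions on the naturals. Addition and zero are the pointwise ones; the algebra product is
  \<open>ga_mult\<close> (not the pointwise \<open>*\<close> of functions).\<close>

type_synonym ga = "(nat \<Rightarrow> nat) \<Rightarrow> complex"

definition group_algebra :: "nat \<Rightarrow> ga set" where
  "group_algebra n = {x. \<forall>\<sigma>. \<sigma> \<notin> Sym n \<longrightarrow> x \<sigma> = 0}"

definition ga_scale :: "complex \<Rightarrow> ga \<Rightarrow> ga" where
  "ga_scale c x = (\<lambda>\<sigma>. c * x \<sigma>)"

definition ga_of :: "(nat \<Rightarrow> nat) \<Rightarrow> ga" where
  "ga_of \<sigma> = (\<lambda>\<tau>. if \<tau> = \<sigma> then 1 else 0)"

definition ga_mult :: "nat \<Rightarrow> ga \<Rightarrow> ga \<Rightarrow> ga" where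
  "ga_mult n x y =
     (\<Sum>\<sigma>\<in>Sym n. \<Sum>\<tau>\<in>Sym n. ga_scale (x \<sigma> * y \<tau>) (ga_of (perm_mult \<sigma> \<tau>)))"

definition ga_inner :: "nat \<Rightarrow> ga \<Rightarrow> ga \<Rightarrow> complex" where
  "ga_inner n x y = (\<Sum>\<sigma>\<in>Sym n. cnj (x \<sigma>) * y \<sigma>)"

definition left_regular :: "nat \<Rightarrow> (nat \<Rightarrow> nat) \<Rightarrow> ga \<Rightarrow> ga" where
  "left_regular n \<sigma> x = ga_mult n (ga_of \<sigma>) x"

interpretation ga: vector_space ga_scale
  by unfold_locales (auto simp: ga_scale_def fun_eq_iff algebra_simps)


section \<open>Irreducible representations and central idempotents\<close>

text \<open>A Young diagram is the list of its row lengths; rows and columns are indexed from zero.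
  It is filled with \<open>1, 2, \<dots>\<close> row by row.\<close>

definition tableau_entry :: "nat list \<Rightarrow> nat \<Rightarrow> nat \<Rightarrow> nat" where
  "tableau_entry lam r c = sum_list (take r lam) + c + 1"

definition tableau_row :: "nat list \<Rightarrow> nat \<Rightarrow> nat set" where
  "tableau_row lam r = {tableau_entry lam r c | c. r < length lam \<and> c < lam ! r}"

definition tableau_col :: "nat list \<Rightarrow> nat \<Rightarrow> nat set" where
  "tableau_col lam c = {tableau_entry lam r c | r. r < length lam \<and> c < lam ! r}"

definition row_group :: "nat \<Rightarrow> nat list \<Rightarrow> (nat \<Rightarrow> nat) set" where
  "row_group n lam = {\<sigma> \<in> Sym n. \<forall>r. \<sigma> ` tableau_row lam r = tableau_row lam r}"

definition col_group :: "nat \<Rightarrow> nat list \<Rightarrow> (nat \<Rightarrow> nat) set" where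
  "col_group n lam = {\<sigma> \<in> Sym n. \<forall>c. \<sigma> ` tableau_col lam c = tableau_col lam c}"

definition young_symmetrizer :: "nat \<Rightarrow> nat list \<Rightarrow> ga" where
  "young_symmetrizer n lam =
     ga_mult n (\<Sum>\<sigma>\<in>row_group n lam. ga_of \<sigma>)
               (\<Sum>\<sigma>\<in>col_group n lam. ga_scale (of_int (sign \<sigma>)) (ga_of \<sigma>))"

text \<open>The irreducible representation with Young diagram \<open>lam\<close>, realised as the left ideal
  generated by the Young symmetrizer.\<close>

definition specht_module :: "nat \<Rightarrow> nat list \<Rightarrow> ga set" where
  "specht_module n lam = (\<lambda>x. ga_mult n x (young_symmetrizer n lam)) ` group_algebra n"

definition central_idempotent :: "nat \<Rightarrow> ga \<Rightarrow> bool" where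
  "central_idempotent n z \<longleftrightarrow> z \<in> group_algebra n \<and> ga_mult n z z = z \<and>
     (\<forall>x\<in>group_algebra n. ga_mult n z x = ga_mult n x z)"

definition primitive_central_idempotent :: "nat \<Rightarrow> ga \<Rightarrow> bool" where
  "primitive_central_idempotent n z \<longleftrightarrow> central_idempotent n z \<and> z \<noteq> 0 \<and>
     \<not> (\<exists>a b. central_idempotent n a \<and> central_idempotent n b \<and> a \<noteq> 0 \<and> b \<noteq> 0 \<and>
            ga_mult n a b = 0 \<and> z = a + b)"

text \<open>The primitive central idempotent corresponding to an irreducible representation is the
  one which acts as the identity in it.\<close>

definition irrep_idempotent :: "nat \<Rightarrow> nat list \<Rightarrow> ga" where
  "irrep_idempotent n lam =
     (THE z. primitive_central_idempotent n z \<and>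
             (\<forall>v\<in>specht_module n lam. ga_mult n z v = v))"


section \<open>The subspace spanned by the elements \<open>e i j\<close>\<close>

definition eps :: "nat \<Rightarrow> nat \<Rightarrow> (nat \<Rightarrow> nat) \<Rightarrow> complex" where
  "eps i j \<sigma> = (if \<sigma> i < \<sigma> j then 1 else -1)"

definition e :: "nat \<Rightarrow> nat \<Rightarrow> nat \<Rightarrow> ga" where
  "e n i j = ga_scale (of_real (1 / sqrt (fact n)))
               (\<Sum>\<sigma>\<in>Sym n. ga_scale (eps i j \<sigma>) (ga_of \<sigma>))"

definition H :: "nat \<Rightarrow> ga set" where
  "H n = ga.span {e n i j | i j. 1 \<le> i \<and> i < j \<and> j \<le> n}"

definition A :: "nat \<Rightarrow> ga" where
  "A n = ga_scale (of_real (sqrt 3 / sqrt (real n + 1)))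
           (irrep_idempotent n [n - 1, 1] +
            ga_scale (of_real (sqrt (real n + 1))) (irrep_idempotent n [n - 2, 1, 1]))"

definition e' :: "nat \<Rightarrow> nat \<Rightarrow> nat \<Rightarrow> ga" where
  "e' n i j = ga_mult n (A n) (e n i j)"


section \<open>Skew-symmetric matrices\<close>

text \<open>An \<open>n \<times> n\<close> matrix has its indices in \<open>{1..n}\<close> and is extended by zero.\<close>

type_synonym cmat = "nat \<Rightarrow> nat \<Rightarrow> complex"

definition mat_scale :: "complex \<Rightarrow> cmat \<Rightarrow> cmat" where
  "mat_scale c a = (\<lambda>i j. c * a i j)"

interpretation cmat: vector_space mat_scale
  by unfold_locales (auto simp: mat_scale_def fun_eq_iff algebra_simps)

definition M :: "nat \<Rightarrow> cmat set" where
  "M n = {a. (\<forall>i j. a j i = - a i j) \<and> (\<forall>i j. i \<notin> {1..n} \<or> j \<notin> {1..n} \<longrightarrow> a i j = 0)}"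

definition mat_inner :: "nat \<Rightarrow> cmat \<Rightarrow> cmat \<Rightarrow> complex" where
  "mat_inner n a b = (\<Sum>(i, j)\<in>{(i, j). 1 \<le> i \<and> i < j \<and> j \<le> n}. cnj (a i j) * b i j)"

definition rho :: "(nat \<Rightarrow> nat) \<Rightarrow> cmat \<Rightarrow> cmat" where
  "rho \<sigma> a = (\<lambda>i j. a (\<sigma> i) (\<sigma> j))"

definition E :: "nat \<Rightarrow> nat \<Rightarrow> cmat" where
  "E i j = (\<lambda>k l. if k = i \<and> l = j then 1 else if k = j \<and> l = i then -1 else 0)"


section \<open>Representations\<close>

definition linear_between ::
  "(complex \<Rightarrow> 'a \<Rightarrow> 'a) \<Rightarrow> 'a set \<Rightarrow> (complex \<Rightarrow> 'b \<Rightarrow> 'b) \<Rightarrow> 'b set \<Rightarrow>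
   ('a::ab_group_add \<Rightarrow> 'b::ab_group_add) \<Rightarrow> bool" where
  "linear_between s V s' W T \<longleftrightarrow> T \<in> V \<rightarrow> W \<and>
     (\<forall>x\<in>V. \<forall>y\<in>V. T (x + y) = T x + T y) \<and> (\<forall>c. \<forall>x\<in>V. T (s c x) = s' c (T x))"

definition representation ::
  "nat \<Rightarrow> (complex \<Rightarrow> 'a \<Rightarrow> 'a) \<Rightarrow> 'a set \<Rightarrow> ((nat \<Rightarrow> nat) \<Rightarrow> 'a::ab_group_add \<Rightarrow> 'a) \<Rightarrow> bool"
  where
  "representation n s V \<pi> \<longleftrightarrow> vector_space s \<and> module.subspace s V \<and>
     (\<forall>\<sigma>\<in>Sym n. linear_between s V s V (\<pi> \<sigma>)) \<and>
     (\<forall>x\<in>V. \<pi> id x = x) \<and>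
     (\<forall>\<sigma>\<in>Sym n. \<forall>\<tau>\<in>Sym n. \<forall>x\<in>V. \<pi> (perm_mult \<sigma> \<tau>) x = \<pi> \<sigma> (\<pi> \<tau> x))"

definition unitary_rep_iso ::
  "nat \<Rightarrow> (complex \<Rightarrow> 'a \<Rightarrow> 'a) \<Rightarrow> 'a set \<Rightarrow> ('a \<Rightarrow> 'a \<Rightarrow> complex) \<Rightarrow>
     ((nat \<Rightarrow> nat) \<Rightarrow> 'a::ab_group_add \<Rightarrow> 'a) \<Rightarrow>
   (complex \<Rightarrow> 'b \<Rightarrow> 'b) \<Rightarrow> 'b set \<Rightarrow> ('b \<Rightarrow> 'b \<Rightarrow> complex) \<Rightarrow>
     ((nat \<Rightarrow> nat) \<Rightarrow> 'b::ab_group_add \<Rightarrow> 'b) \<Rightarrow>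
   ('a \<Rightarrow> 'b) \<Rightarrow> bool" where
  "unitary_rep_iso n s V ip \<pi> s' W ip' \<pi>' T \<longleftrightarrow>
     representation n s V \<pi> \<and> representation n s' W \<pi>' \<and>
     linear_between s V s' W T \<and> bij_betw T V W \<and>
     (\<forall>x\<in>V. \<forall>y\<in>V. ip' (T x) (T y) = ip x y) \<and>
     (\<forall>\<sigma>\<in>Sym n. \<forall>x\<in>V. T (\<pi> \<sigma> x) = \<pi>' \<sigma> (T x))"

end

theory Submission
  imports Defs
begin

text \<open>Put \<open>u i j = \<Sum>\<^sub>\<sigma> sgn (\<sigma> j - \<sigma> i) \<sigma>\<close>, a multiple of \<open>e i j\<close>, and \<open>h i = \<Sum>\<^sub>k u i k\<close>, whose coefficient
  at \<open>\<sigma>\<close> is \<open>n + 1 - 2 \<sigma> i\<close>. Then \<open>n u i j = (h i - h j) + g i j\<close>, where \<open>h i\<close> is a combination of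
  translates of the Young symmetrizer of \<open>(n-1,1)\<close> and \<open>g i j\<close> one of translates of that of \<open>(n-2,1,1)\<close>;
  so \<open>C\<^sub>1\<close> and \<open>C\<^sub>2\<close> project \<open>n u i j\<close> onto the two summands. The Gram matrix of the \<open>u i j\<close> is determined
  by the value \<open>n!/3\<close> for two vectors sharing an index, and it makes the \<open>e' i j\<close>
  orthonormal. The operator is therefore \<open>x \<mapsto> (\<langle>e' i j, x\<rangle>)\<^sub>i\<^sub>j\<close>, and it is equivariant because left
  multiplication permutes the \<open>e' i j\<close> up to sign as \<open>rho\<close> permutes the \<open>E i j\<close>.\<close>

subsection \<open>The group algebra as a star-algebra\<close>

text \<open>The constants in \<open>A\<close> come from a spectrum. Read as an operator on
  skew-symmetric matrices, the Gram matrix of the \<open>e i j\<close> is one third of the identity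
  plus n/3 times the orthogonal projection onto the matrices with entries \<open>x i - x j\<close>.
  Its eigenvalues are (n+1)/3 and 1/3, belonging to the components of shapes (n-1,1) and (n-2,1,1),
  and \<open>A\<close> divides each component by the square root of its eigenvalue. The idempotents
  are given by a definite description, so existence and uniqueness must be settled before anything
  can be computed. Positivity does the work of semisimplicity: the coefficient at the identity of
  \<open>x\<close> times its adjoint is the squared norm of \<open>x\<close>. Hence a nonzero
  \<open>c\<close> for which every \<open>c x c\<close> is a multiple of \<open>c\<close> yields its
  own primitive central idempotent. No characters are needed to see where a vector lies: a central
  element acts on all two-sided translates of \<open>c\<close> by the scalar with which it acts on
  \<open>c\<close>.\<close>

lemma sum_fun_apply: "(\<Sum>a\<in>S. f a) x = (\<Sum>a\<in>S. f a x)"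
  for f :: "'a \<Rightarrow> 'b \<Rightarrow> 'c::comm_monoid_add"
  by (induction S rule: infinite_finite_induct) auto

lemma finite_Sym [simp]: "finite (Sym n)"
  by (simp add: Sym_def finite_permutations)

lemma id_in_Sym [simp]: "id \<in> Sym n"
  by (simp add: Sym_def permutes_id)

lemma comp_in_Sym [simp]: "\<sigma> \<in> Sym n \<Longrightarrow> \<tau> \<in> Sym n \<Longrightarrow> \<sigma> \<circ> \<tau> \<in> Sym n"
  by (simp add: Sym_def permutes_compose)

lemma inv_in_Sym [simp]: "\<sigma> \<in> Sym n \<Longrightarrow> inv \<sigma> \<in> Sym n"
  by (simp add: Sym_def permutes_inv)

lemma inv_inv_Sym [simp]: "\<sigma> \<in> Sym n \<Longrightarrow> inv (inv \<sigma>) = \<sigma>"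
  by (simp add: Sym_def permutes_inv_inv)

lemma inv_o_Sym [simp]:
  assumes "\<sigma> \<in> Sym n"
  shows "\<sigma> \<circ> inv \<sigma> = id" "inv \<sigma> \<circ> \<sigma> = id" "\<sigma> (inv \<sigma> i) = i" "inv \<sigma> (\<sigma> i) = i"
  using assms by (simp_all add: Sym_def permutes_inv_o permutes_inverses)

lemma inj_Sym: "\<sigma> \<in> Sym n \<Longrightarrow> \<sigma> i = \<sigma> j \<longleftrightarrow> i = j"
  by (metis inv_o_Sym(4))

lemma Sym_in_range [simp]: "\<sigma> \<in> Sym n \<Longrightarrow> \<sigma> i \<in> {1..n} \<longleftrightarrow> i \<in> {1..n}"
  using permutes_in_image[of \<sigma> "{1..n}" i] by (simp add: Sym_def)

lemma Sym_comp_cancel: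
  assumes "\<sigma> \<in> Sym n"
  shows "\<rho> = \<tau> \<circ> \<sigma> \<longleftrightarrow> \<tau> = \<rho> \<circ> inv \<sigma>" "\<rho> = \<sigma> \<circ> \<tau> \<longleftrightarrow> \<tau> = inv \<sigma> \<circ> \<rho>"
  using inv_o_Sym(3,4)[OF assms] by (auto simp: fun_eq_iff)

lemma ga_apply [simp]:
  "ga_scale c x \<sigma> = c * x \<sigma>" "ga_of \<tau> \<sigma> = (if \<sigma> = \<tau> then 1 else 0)"
  by (simp_all add: ga_scale_def ga_of_def)

lemma sum_Sym_comp_right: "\<pi> \<in> Sym n \<Longrightarrow> (\<Sum>\<sigma>\<in>Sym n. f (\<sigma> \<circ> \<pi>)) = (\<Sum>\<sigma>\<in>Sym n. f \<sigma>)"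
  using sum_permutations_compose_right[of \<pi> "{1..n}" f] by (simp add: Sym_def)

lemma sum_Sym_inv: "(\<Sum>\<sigma>\<in>Sym n. f (inv \<sigma>)) = (\<Sum>\<sigma>\<in>Sym n. f \<sigma>)"
  using sum_permutations_inverse[of f "{1..n}"] by (simp add: Sym_def)

lemma transpose_in_Sym: "i \<in> {1..n} \<Longrightarrow> j \<in> {1..n} \<Longrightarrow> transpose i j \<in> Sym n"
  by (simp add: Sym_def permutes_swap_id)

text \<open>Products run from left to right, so the pair \<open>\<sigma>\<close>,
  \<open>\<tau>\<close> contributes at \<open>\<tau> \<circ> \<sigma>\<close>; all later formulas
  with \<open>\<circ>\<close> show this reversal.\<close>

lemma ga_mult_apply:
  "ga_mult n x y \<rho> = (\<Sum>\<sigma>\<in>Sym n. \<Sum>\<tau>\<in>Sym n. if \<rho> = \<tau> \<circ> \<sigma> then x \<sigma> * y \<tau> else 0)"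
  unfolding ga_mult_def sum_fun_apply ga_scale_def ga_of_def perm_mult_def
  by (intro sum.cong refl) (auto simp: o_def)

lemma ga_mult_apply_right:
  assumes "\<rho> \<in> Sym n"
  shows "ga_mult n x y \<rho> = (\<Sum>\<sigma>\<in>Sym n. x \<sigma> * y (\<rho> \<circ> inv \<sigma>))"
  unfolding ga_mult_apply
  using assms by (intro sum.cong refl) (simp add: Sym_comp_cancel(1) del: o_apply)

lemma ga_mult_apply_left:
  assumes "\<rho> \<in> Sym n"
  shows "ga_mult n x y \<rho> = (\<Sum>\<tau>\<in>Sym n. x (inv \<tau> \<circ> \<rho>) * y \<tau>)"
  unfolding ga_mult_apply
  using assms by (subst sum.swap, intro sum.cong refl) (simp add: Sym_comp_cancel(2))

lemma ga_mult_closed [simp]: "ga_mult n x y \<in> group_algebra n"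
  unfolding group_algebra_def ga_mult_apply
  by (auto intro!: sum.neutral)

lemma group_algebra_subspace: "ga.subspace (group_algebra n)"
  by (auto simp: ga.subspace_def group_algebra_def ga_scale_def)

lemmas group_algebra_closed [simp] =
  ga.subspace_0[OF group_algebra_subspace] ga.subspace_add[OF group_algebra_subspace]
  ga.subspace_diff[OF group_algebra_subspace] ga.subspace_scale[OF group_algebra_subspace]
  ga.subspace_sum[OF group_algebra_subspace]

lemma ga_of_closed [simp]: "\<sigma> \<in> Sym n \<Longrightarrow> ga_of \<sigma> \<in> group_algebra n"
  by (auto simp: group_algebra_def ga_of_def)

lemma group_algebra_eqI:
  assumes "x \<in> group_algebra n" "y \<in> group_algebra n" "\<And>\<sigma>. \<sigma> \<in> Sym n \<Longrightarrow> x \<sigma> = y \<sigma>"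
  shows "x = y"
  using assms by (fastforce simp: group_algebra_def fun_eq_iff)

lemma ga_mult_add_left: "ga_mult n (x + y) z = ga_mult n x z + ga_mult n y z"
  by (rule group_algebra_eqI[of _ n])
    (simp_all add: ga_mult_apply_right distrib_right sum.distrib)

lemma ga_mult_add_right: "ga_mult n z (x + y) = ga_mult n z x + ga_mult n z y"
  by (rule group_algebra_eqI[of _ n])
    (simp_all add: ga_mult_apply_right distrib_left sum.distrib)

lemma ga_mult_scale_left: "ga_mult n (ga_scale c x) y = ga_scale c (ga_mult n x y)"
  by (rule group_algebra_eqI[of _ n])
    (simp_all add: ga_mult_apply_right sum_distrib_left mult.assoc)

lemma ga_mult_scale_right: "ga_mult n x (ga_scale c y) = ga_scale c (ga_mult n x y)"
  by (rule group_algebra_eqI[of _ n])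
    (simp_all add: ga_mult_apply_right sum_distrib_left mult.left_commute)

lemma ga_mult_zero [simp]: "ga_mult n 0 x = 0" "ga_mult n x 0 = 0"
  by (rule group_algebra_eqI[of _ n]; simp add: ga_mult_apply_right)+

lemma ga_mult_diff_left: "ga_mult n (x - y) z = ga_mult n x z - ga_mult n y z"
  using ga_mult_add_left[of n "x - y" y z] by (simp add: algebra_simps)

lemma ga_mult_diff_right: "ga_mult n z (x - y) = ga_mult n z x - ga_mult n z y"
  using ga_mult_add_right[of n z "x - y" y] by (simp add: algebra_simps)

lemma ga_mult_minus: "ga_mult n (- x) y = - ga_mult n x y" "ga_mult n x (- y) = - ga_mult n x y"
  using ga_mult_diff_left[of n 0 x y] ga_mult_diff_right[of n x 0 y] by simp_all

lemma ga_mult_sum_left: "ga_mult n (\<Sum>a\<in>S. f a) y = (\<Sum>a\<in>S. ga_mult n (f a) y)"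
  by (rule group_algebra_eqI[of _ n])
    (simp_all add: ga_mult_apply_right sum_fun_apply sum_distrib_right, subst sum.swap, rule refl)

lemma ga_mult_sum_right: "ga_mult n y (\<Sum>a\<in>S. f a) = (\<Sum>a\<in>S. ga_mult n y (f a))"
  by (rule group_algebra_eqI[of _ n])
    (simp_all add: ga_mult_apply_right sum_fun_apply sum_distrib_left, subst sum.swap, rule refl)

lemmas ga_mult_linear = ga_mult_add_left ga_mult_add_right ga_mult_scale_left ga_mult_scale_right
  ga_mult_diff_left ga_mult_diff_right ga_mult_minus ga_mult_sum_left ga_mult_sum_right

lemma ga_of_mult_apply:
  assumes "\<sigma> \<in> Sym n" "\<rho> \<in> Sym n"
  shows "ga_mult n (ga_of \<sigma>) x \<rho> = x (\<rho> \<circ> inv \<sigma>)"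
  using assms unfolding ga_mult_apply_right[OF assms(2)]
  by (simp add: if_distrib[of "\<lambda>c. c * _"] cong: if_cong)

lemma mult_ga_of_apply:
  assumes "\<sigma> \<in> Sym n" "\<rho> \<in> Sym n"
  shows "ga_mult n x (ga_of \<sigma>) \<rho> = x (inv \<sigma> \<circ> \<rho>)"
  using assms unfolding ga_mult_apply_left[OF assms(2)]
  by (simp add: if_distrib[of "(*) _"] cong: if_cong)

lemma ga_of_mult_ga_of:
  assumes "\<sigma> \<in> Sym n" "\<tau> \<in> Sym n"
  shows "ga_mult n (ga_of \<sigma>) (ga_of \<tau>) = ga_of (\<tau> \<circ> \<sigma>)"
proof (rule group_algebra_eqI[of _ n])
  fix \<rho> assume "\<rho> \<in> Sym n"
  with assms show "ga_mult n (ga_of \<sigma>) (ga_of \<tau>) \<rho> = ga_of (\<tau> \<circ> \<sigma>) \<rho>"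
    by (simp add: ga_of_mult_apply) (metis Sym_comp_cancel(1))
qed (use assms in auto)

lemma ga_expand: "x \<in> group_algebra n \<Longrightarrow> x = (\<Sum>\<sigma>\<in>Sym n. ga_scale (x \<sigma>) (ga_of \<sigma>))"
  by (rule group_algebra_eqI[of _ n])
    (auto simp: sum_fun_apply if_distrib[of "(*) _"] cong: if_cong)

lemma ga_one_mult [simp]:
  assumes "x \<in> group_algebra n"
  shows "ga_mult n (ga_of id) x = x" "ga_mult n x (ga_of id) = x"
  by (rule group_algebra_eqI[of _ n]; use assms in \<open>simp add: ga_of_mult_apply mult_ga_of_apply\<close>)+

lemma ga_mult_assoc: "ga_mult n (ga_mult n x y) z = ga_mult n x (ga_mult n y z)"
proof (rule group_algebra_eqI[of _ n])
  fix \<rho> assume \<rho>: "\<rho> \<in> Sym n"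
  have "ga_mult n (ga_mult n x y) z \<rho> =
      (\<Sum>\<tau>\<in>Sym n. (\<Sum>\<sigma>\<in>Sym n. x \<sigma> * y (inv \<tau> \<circ> \<rho> \<circ> inv \<sigma>)) * z \<tau>)"
    unfolding ga_mult_apply_left[OF \<rho>] using \<rho> by (simp add: ga_mult_apply_right)
  also have "\<dots> = (\<Sum>\<sigma>\<in>Sym n. x \<sigma> * (\<Sum>\<tau>\<in>Sym n. y (inv \<tau> \<circ> (\<rho> \<circ> inv \<sigma>)) * z \<tau>))"
    unfolding sum_distrib_left sum_distrib_right by (subst sum.swap) (simp add: o_assoc mult.assoc)
  also have "\<dots> = ga_mult n x (ga_mult n y z) \<rho>"
    unfolding ga_mult_apply_right[OF \<rho>] using \<rho> by (simp add: ga_mult_apply_left)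
  finally show "ga_mult n (ga_mult n x y) z \<rho> = ga_mult n x (ga_mult n y z) \<rho>" .
qed auto

section \<open>The involution that inverts group elements and conjugates scalars, and its
  positivity\<close>

definition ga_adj :: "nat \<Rightarrow> ga \<Rightarrow> ga" where
  "ga_adj n x = (\<lambda>\<sigma>. if \<sigma> \<in> Sym n then cnj (x (inv \<sigma>)) else 0)"

lemma ga_adj_apply [simp]: "\<sigma> \<in> Sym n \<Longrightarrow> ga_adj n x \<sigma> = cnj (x (inv \<sigma>))"
  by (simp add: ga_adj_def)

lemma ga_adj_closed [simp]: "ga_adj n x \<in> group_algebra n"
  by (simp add: group_algebra_def ga_adj_def)

lemma ga_adj_mult: "ga_adj n (ga_mult n x y) = ga_mult n (ga_adj n y) (ga_adj n x)"
proof (rule group_algebra_eqI[of _ n])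
  fix \<rho> assume \<rho>: "\<rho> \<in> Sym n"
  have "ga_adj n (ga_mult n x y) \<rho> = (\<Sum>\<sigma>\<in>Sym n. cnj (y \<sigma>) * cnj (x (inv \<sigma> \<circ> inv \<rho>)))"
    using \<rho> by (simp add: ga_mult_apply_left mult.commute)
  also have "\<dots> = (\<Sum>\<sigma>\<in>Sym n. cnj (y (inv \<sigma>)) * cnj (x (\<sigma> \<circ> inv \<rho>)))"
    by (subst sum_Sym_inv[symmetric]) simp
  also have "\<dots> = ga_mult n (ga_adj n y) (ga_adj n x) \<rho>"
    unfolding ga_mult_apply_right[OF \<rho>]
  proof (intro sum.cong refl)
    fix \<sigma> assume \<sigma>: "\<sigma> \<in> Sym n"
    have "inv (\<rho> \<circ> inv \<sigma>) = \<sigma> \<circ> inv \<rho>"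
      using \<sigma> \<rho> by (intro inv_unique_comp) (simp_all add: fun_eq_iff)
    with \<sigma> \<rho> show "cnj (y (inv \<sigma>)) * cnj (x (\<sigma> \<circ> inv \<rho>)) = ga_adj n y \<sigma> * ga_adj n x (\<rho> \<circ> inv \<sigma>)"
      by simp
  qed
  finally show "ga_adj n (ga_mult n x y) \<rho> = ga_mult n (ga_adj n y) (ga_adj n x) \<rho>" .
qed auto

lemma ga_adj_adj [simp]: "x \<in> group_algebra n \<Longrightarrow> ga_adj n (ga_adj n x) = x"
  by (rule group_algebra_eqI[of _ n]) auto

lemma ga_adj_ga_of [simp]: "\<sigma> \<in> Sym n \<Longrightarrow> ga_adj n (ga_of \<sigma>) = ga_of (inv \<sigma>)"
  by (rule group_algebra_eqI[of _ n]) auto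

lemma ga_adj_sum: "ga_adj n (\<Sum>a\<in>S. f a) = (\<Sum>a\<in>S. ga_adj n (f a))"
  by (rule group_algebra_eqI[of _ n]) (auto simp: sum_fun_apply)

lemma ga_mult_adj_id: "ga_mult n x (ga_adj n x) id = (\<Sum>\<sigma>\<in>Sym n. of_real ((cmod (x \<sigma>))\<^sup>2))"
  by (simp add: ga_mult_apply_right complex_norm_square del: of_real_power)

text \<open>The coefficient is a sum of squared absolute values. This is the only source of
  positivity in the construction of the idempotents.\<close>

lemma ga_mult_adj_id_nonzero:
  assumes "x \<in> group_algebra n" "x \<noteq> 0"
  shows "ga_mult n x (ga_adj n x) id \<noteq> 0"
proof
  assume "ga_mult n x (ga_adj n x) id = 0"
  hence "(\<Sum>\<sigma>\<in>Sym n. (cmod (x \<sigma>))\<^sup>2) = 0"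
    unfolding ga_mult_adj_id of_real_sum[symmetric] of_real_eq_0_iff .
  hence "\<forall>\<sigma>\<in>Sym n. x \<sigma> = 0" by (subst (asm) sum_nonneg_eq_0_iff) auto
  with assms show False by (auto simp: group_algebra_def fun_eq_iff)
qed

lemma ga_mult_adj_nonzero:
  assumes "x \<in> group_algebra n" "x \<noteq> 0"
  shows "ga_mult n x (ga_adj n x) \<noteq> 0"
  using ga_mult_adj_id_nonzero[OF assms] by auto

subsection \<open>The primitive central idempotent belonging to a primitive element\<close>

text \<open>Up to the factor \<open>card (Sym n)\<close>, the projection of the group algebra onto
  its centre.\<close>

definition conj_sum :: "nat \<Rightarrow> ga \<Rightarrow> ga" where
  "conj_sum n x = (\<Sum>\<sigma>\<in>Sym n. ga_mult n (ga_of \<sigma>) (ga_mult n x (ga_of (inv \<sigma>))))"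

lemma conj_sum_closed [simp]: "conj_sum n x \<in> group_algebra n"
  by (simp add: conj_sum_def)

text \<open>Moving a group element \<open>\<tau>\<close> through the sum amounts to the reindexing
  \<open>\<sigma> \<mapsto> \<sigma> \<circ> \<tau>\<close>; linearity then covers every
  \<open>y\<close>.\<close>

lemma conj_sum_central:
  assumes y: "y \<in> group_algebra n"
  shows "ga_mult n y (conj_sum n x) = ga_mult n (conj_sum n x) y"
proof -
  have "ga_mult n (ga_of \<tau>) (conj_sum n x) = ga_mult n (conj_sum n x) (ga_of \<tau>)" if \<tau>: "\<tau> \<in> Sym n" for \<tau>
  proof -
    let ?f = "\<lambda>\<sigma>. ga_mult n (ga_of \<sigma>) (ga_mult n x (ga_of (\<tau> \<circ> inv \<sigma>)))"
    have "ga_mult n (ga_of \<tau>) (conj_sum n x) =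
        (\<Sum>\<sigma>\<in>Sym n. ga_mult n (ga_of (\<sigma> \<circ> \<tau>)) (ga_mult n x (ga_of (inv \<sigma>))))"
      unfolding conj_sum_def ga_mult_sum_right
      by (intro sum.cong refl) (simp add: ga_mult_assoc[symmetric] ga_of_mult_ga_of \<tau>)
    also have "\<dots> = (\<Sum>\<sigma>\<in>Sym n. ?f (\<sigma> \<circ> \<tau>))"
    proof (intro sum.cong refl)
      fix \<sigma> assume \<sigma>: "\<sigma> \<in> Sym n"
      have "inv (\<sigma> \<circ> \<tau>) = inv \<tau> \<circ> inv \<sigma>"
        using \<sigma> \<tau> by (intro inv_unique_comp) (simp_all add: fun_eq_iff)
      hence "\<tau> \<circ> inv (\<sigma> \<circ> \<tau>) = inv \<sigma>" using \<tau> by (simp add: fun_eq_iff)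
      thus "ga_mult n (ga_of (\<sigma> \<circ> \<tau>)) (ga_mult n x (ga_of (inv \<sigma>))) = ?f (\<sigma> \<circ> \<tau>)" by simp
    qed
    also have "\<dots> = (\<Sum>\<sigma>\<in>Sym n. ?f \<sigma>)" by (rule sum_Sym_comp_right[OF \<tau>])
    also have "\<dots> = ga_mult n (conj_sum n x) (ga_of \<tau>)"
      unfolding conj_sum_def ga_mult_sum_left
      by (intro sum.cong refl) (simp add: ga_mult_assoc ga_of_mult_ga_of \<tau>)
    finally show ?thesis .
  qed
  thus ?thesis by (subst (1 2) ga_expand[OF y]) (simp add: ga_mult_linear)
qed

text \<open>Conjugation preserves the coefficient at the identity, so an element in which it is
  nonzero survives the summation.\<close>

lemma conj_sum_id: "conj_sum n x id = of_nat (card (Sym n)) * x id"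
  by (simp add: conj_sum_def sum_fun_apply ga_of_mult_apply mult_ga_of_apply)

lemma conj_sum_adj: "ga_adj n (conj_sum n x) = conj_sum n (ga_adj n x)"
  unfolding conj_sum_def ga_adj_sum
  by (intro sum.cong refl) (simp add: ga_adj_mult ga_mult_assoc)

text \<open>A central \<open>z\<close> slides past each conjugating group element until it meets
  \<open>x\<close>.\<close>

lemma mult_conj_sum_eq_0:
  assumes z: "\<And>y. y \<in> group_algebra n \<Longrightarrow> ga_mult n z y = ga_mult n y z" and "ga_mult n z x = 0"
  shows "ga_mult n z (conj_sum n x) = 0"
proof -
  have "ga_mult n z (ga_mult n (ga_of \<sigma>) (ga_mult n x (ga_of (inv \<sigma>)))) = 0" if "\<sigma> \<in> Sym n" for \<sigma>
  proof -
    have "ga_mult n z (ga_mult n (ga_of \<sigma>) (ga_mult n x (ga_of (inv \<sigma>)))) =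
      ga_mult n (ga_mult n z (ga_of \<sigma>)) (ga_mult n x (ga_of (inv \<sigma>)))" by (simp add: ga_mult_assoc)
    also have "\<dots> = ga_mult n (ga_of \<sigma>) (ga_mult n (ga_mult n z x) (ga_of (inv \<sigma>)))"
      using that by (simp add: z ga_mult_assoc)
    finally show ?thesis using assms(2) by simp
  qed
  thus ?thesis by (simp add: conj_sum_def ga_mult_sum_right)
qed

lemma central_idempotentD:
  assumes "central_idempotent n z"
  shows "z \<in> group_algebra n" "ga_mult n z z = z"
    "x \<in> group_algebra n \<Longrightarrow> ga_mult n z x = ga_mult n x z"
  using assms by (auto simp: central_idempotent_def)

text \<open>The witness is a multiple of \<open>\<Sum>\<^sub>\<sigma> \<sigma> c c\<^sup>* \<sigma>\<^sup>-\<^sup>1\<close>. Centrality is clear and the centre acts on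
  \<open>c\<close> by scalars; the scalar by which this element acts cannot vanish, for otherwise a nonzero
  self-adjoint element would be nilpotent.\<close>

theorem primitive_central_idempotent_exists:
  assumes c: "c \<in> group_algebra n" "c \<noteq> 0"
    and prim: "\<And>x. x \<in> group_algebra n \<Longrightarrow> \<exists>k. ga_mult n c (ga_mult n x c) = ga_scale k c"
  obtains k where
    "primitive_central_idempotent n (ga_scale k (conj_sum n (ga_mult n c (ga_adj n c))))"
    "ga_mult n (ga_scale k (conj_sum n (ga_mult n c (ga_adj n c)))) c = c"
proof -
  define p where "p = ga_mult n c (ga_adj n c)"
  define w where "w = conj_sum n p"
  have p: "p \<in> group_algebra n" "ga_adj n p = p" "p id \<noteq> 0"
    using ga_mult_adj_id_nonzero[OF c] c by (auto simp: p_def ga_adj_mult)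
  have w: "w \<in> group_algebra n" "ga_adj n w = w"
    using p by (simp_all add: w_def conj_sum_adj)
  have w_central: "\<And>y. y \<in> group_algebra n \<Longrightarrow> ga_mult n w y = ga_mult n y w"
    by (simp add: w_def conj_sum_central)
  have "card (Sym n) \<noteq> 0" by (metis card_0_eq empty_iff finite_Sym id_in_Sym)
  hence "w id \<noteq> 0" using p by (simp add: w_def conj_sum_id)
  hence "w \<noteq> 0" by auto
  hence ww: "ga_mult n w w \<noteq> 0" using ga_mult_adj_nonzero[OF w(1)] w by simp
  \<comment> \<open>\<open>p\<close> is self-adjoint and nonzero, so \<open>p p\<close> is nonzero
    by positivity; it equals \<open>l p\<close>, which makes \<open>l\<close> invertible.\<close>
  obtain l where l: "ga_mult n p c = ga_scale l c"
    using prim[of "ga_adj n c"] by (auto simp: p_def ga_mult_assoc)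
  have "ga_mult n p p \<noteq> 0"
    using ga_mult_adj_nonzero[OF p(1)] p by fastforce
  moreover have "ga_mult n p p = ga_scale l p"
    using l by (simp add: p_def ga_mult_assoc[symmetric] ga_mult_scale_left)
  ultimately have "l \<noteq> 0" by auto
  \<comment> \<open>Up to the invertible factor \<open>l\<close>, the product \<open>z c\<close> is
    \<open>z p c\<close>. Centrality turns this into \<open>c y c\<close> with \<open>y\<close> the
    product of \<open>z\<close> and the adjoint of \<open>c\<close>, and \<open>prim\<close>
    applies.\<close>
  have scalar: "\<exists>k. ga_mult n z c = ga_scale k c"
    if z: "z \<in> group_algebra n" "\<And>y. y \<in> group_algebra n \<Longrightarrow> ga_mult n z y = ga_mult n y z" for z
  proof -
    obtain k where k: "ga_mult n c (ga_mult n (ga_mult n z (ga_adj n c)) c) = ga_scale k c"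
      using prim[of "ga_mult n z (ga_adj n c)"] by auto
    have "ga_scale l (ga_mult n z c) = ga_mult n z (ga_mult n p c)"
      by (simp add: l ga_mult_scale_right)
    also have "\<dots> = ga_mult n (ga_mult n z c) (ga_mult n (ga_adj n c) c)"
      by (simp add: p_def ga_mult_assoc)
    also have "\<dots> = ga_scale k c"
      using k by (simp add: z(2)[OF c(1)] ga_mult_assoc)
    finally have "ga_scale l (ga_mult n z c) = ga_scale k c" .
    hence "ga_scale (inverse l) (ga_scale l (ga_mult n z c)) = ga_scale (inverse l * k) c"
      by simp
    with \<open>l \<noteq> 0\<close> show ?thesis by auto
  qed
  obtain s where s: "ga_mult n w c = ga_scale s c" using scalar[OF w(1) w_central] by blast
  have wp: "ga_mult n w p = ga_scale s p"
    by (simp add: p_def ga_mult_assoc[symmetric] s ga_mult_scale_left)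
  have "s \<noteq> 0"
  proof
    assume "s = 0"
    hence "ga_mult n w p = 0" using wp by simp
    hence "ga_mult n w w = 0"
      unfolding w_def using conj_sum_central by (intro mult_conj_sum_eq_0) (auto simp: w_def)
    with ww show False by simp
  qed
  \<comment> \<open>The central element \<open>w - s\<close> kills \<open>p\<close>, hence also the
    sum \<open>w\<close> of the conjugates of \<open>p\<close>. So \<open>w\<close> is idempotent up
    to the factor \<open>s\<close>.\<close>
  have "ga_mult n (w - ga_scale s (ga_of id)) p = 0"
    using p(1) by (simp add: ga_mult_linear wp)
  hence "ga_mult n (w - ga_scale s (ga_of id)) w = 0"
    unfolding w_def
    by (intro mult_conj_sum_eq_0) (auto simp: ga_mult_linear conj_sum_central)
  hence ws: "ga_mult n w w = ga_scale s w"
    using w by (simp add: ga_mult_linear)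
  define z where "z = ga_scale (inverse s) w"
  have zc: "ga_mult n z c = c"
    using \<open>s \<noteq> 0\<close> by (simp add: z_def ga_mult_linear s)
  have z: "central_idempotent n z"
    unfolding central_idempotent_def z_def
  proof (intro conjI ballI)
    show "ga_mult n (ga_scale (inverse s) w) (ga_scale (inverse s) w) = ga_scale (inverse s) w"
      using \<open>s \<noteq> 0\<close> by (simp add: ga_mult_linear ws)
    show "ga_mult n (ga_scale (inverse s) w) y = ga_mult n y (ga_scale (inverse s) w)"
      if "y \<in> group_algebra n" for y
      using w_central[OF that] by (simp add: ga_mult_linear)
  qed (use w in simp)
  \<comment> \<open>Nothing nonzero below \<open>z\<close> can kill \<open>c\<close>: killing
    \<open>c\<close> means killing \<open>p\<close>, hence \<open>w\<close>, hence
    \<open>z\<close>.\<close>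
  have aux: "a = 0" if a: "central_idempotent n a" "ga_mult n a z = a" "ga_mult n a c = 0" for a
  proof -
    have "ga_mult n a p = 0" using a(3) by (simp add: p_def ga_mult_assoc[symmetric])
    hence "ga_mult n a w = 0"
      unfolding w_def using central_idempotentD(3)[OF a(1)] by (intro mult_conj_sum_eq_0) auto
    with a(2) show ?thesis by (simp add: z_def ga_mult_linear)
  qed
  have "primitive_central_idempotent n z"
    unfolding primitive_central_idempotent_def
  proof (intro conjI notI)
    show "central_idempotent n z" by (rule z)
    show False if "z = 0" using zc c(2) that by simp
    assume "\<exists>a b. central_idempotent n a \<and> central_idempotent n b \<and> a \<noteq> 0 \<and> b \<noteq> 0 \<and>
      ga_mult n a b = 0 \<and> z = a + b"
    then obtain a b where a: "central_idempotent n a" "a \<noteq> 0" and b: "central_idempotent n b" "b \<noteq> 0"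
      and ab: "ga_mult n a b = 0" and zab: "z = a + b" by blast
    note [simp] = central_idempotentD(1,2)[OF a(1)] central_idempotentD(1,2)[OF b(1)]
    have ba: "ga_mult n b a = 0" using ab by (simp add: central_idempotentD(3)[OF b(1)])
    \<comment> \<open>Idempotence forces \<open>k\<close> to be 0 or 1, so one of the two summands
      kills \<open>c\<close> and vanishes by \<open>aux\<close>.\<close>
    obtain k where k: "ga_mult n a c = ga_scale k c"
      using scalar[of a] central_idempotentD(3)[OF a(1)] by auto
    have "ga_scale (k * k) c = ga_mult n a (ga_mult n a c)" by (simp add: k ga_mult_linear)
    also have "\<dots> = ga_scale k c" by (simp add: ga_mult_assoc[symmetric]) (simp add: k)
    finally have "k * k = k" using c(2) by simp
    hence "k = 0 \<or> k = 1" by simp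
    moreover have "a = 0" if "k = 0"
      by (rule aux[OF a(1)]) (use that in \<open>simp_all add: zab ga_mult_linear ab k\<close>)
    moreover have "b = 0" if "k = 1"
    proof (rule aux[OF b(1)])
      show "ga_mult n b c = 0" using zc that by (simp add: zab ga_mult_linear k)
    qed (simp add: zab ga_mult_linear ba)
    ultimately show False using a b by blast
  qed
  with zc show thesis by (intro that[of "inverse s"]) (simp_all add: z_def w_def p_def)
qed

text \<open>The product of the two is a central idempotent that fixes \<open>c\<close>, hence is
  nonzero. It splits each factor into two orthogonal parts, and primitivity makes the second part
  vanish, so both equal the product.\<close>

theorem primitive_central_idempotent_unique:
  assumes "primitive_central_idempotent n z" "primitive_central_idempotent n z'"
    and "c \<noteq> 0" "ga_mult n z c = c" "ga_mult n z' c = c"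
  shows "z = z'"
proof -
  have *: "z1 = ga_mult n z1 z2"
    if z12: "primitive_central_idempotent n z1" "central_idempotent n z2" "ga_mult n z1 c = c" "ga_mult n z2 c = c"
    for z1 z2
  proof -
    have z1: "central_idempotent n z1" using z12(1) by (simp add: primitive_central_idempotent_def)
    note [simp] = central_idempotentD(1,2)[OF z1] central_idempotentD(1,2)[OF z12(2)]
    define p where "p = ga_mult n z1 z2"
    have z1p: "ga_mult n z1 p = p" by (simp add: p_def ga_mult_assoc[symmetric])
    have "ga_mult n p p = ga_mult n (ga_mult n z1 (ga_mult n z2 z1)) z2"
      by (simp add: p_def ga_mult_assoc)
    also have "\<dots> = ga_mult n (ga_mult n z1 z1) (ga_mult n z2 z2)"
      by (simp only: central_idempotentD(3)[OF z12(2) central_idempotentD(1)[OF z1]] ga_mult_assoc)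
    finally have pp: "ga_mult n p p = p" by (simp add: p_def)
    have pc: "ga_mult n p y = ga_mult n y p" if "y \<in> group_algebra n" for y
    proof -
      have "ga_mult n p y = ga_mult n z1 (ga_mult n y z2)"
        by (simp add: p_def ga_mult_assoc central_idempotentD(3)[OF z12(2) that])
      also have "\<dots> = ga_mult n y p"
        by (simp add: p_def ga_mult_assoc[symmetric] central_idempotentD(3)[OF z1 that])
      finally show ?thesis .
    qed
    have p: "central_idempotent n p"
      unfolding central_idempotent_def by (intro conjI ballI pp pc) (simp_all add: p_def)
    have q: "central_idempotent n (z1 - p)"
      unfolding central_idempotent_def
    proof (intro conjI ballI)
      show "z1 - p \<in> group_algebra n" by (simp add: p_def)
      show "ga_mult n (z1 - p) (z1 - p) = z1 - p"
        using pc[of z1] by (simp add: ga_mult_linear z1p pp)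
      show "ga_mult n (z1 - p) y = ga_mult n y (z1 - p)" if "y \<in> group_algebra n" for y
        using pc[OF that] central_idempotentD(3)[OF z1 that] by (simp add: ga_mult_linear)
    qed
    have "ga_mult n p c = c" by (simp add: p_def ga_mult_assoc z12(3,4))
    hence "p \<noteq> 0" using assms(3) by auto
    moreover have "ga_mult n p (z1 - p) = 0" using pc[of z1] by (simp add: ga_mult_linear z1p pp)
    moreover have "z1 = p + (z1 - p)" by simp
    ultimately have "z1 - p = 0"
      using z12(1) p q unfolding primitive_central_idempotent_def by blast
    thus ?thesis by (simp add: p_def)
  qed
  have ci: "central_idempotent n z" "central_idempotent n z'"
    using assms by (simp_all add: primitive_central_idempotent_def)
  have "z = ga_mult n z z'" using * assms ci by blast
  also have "\<dots> = ga_mult n z' z" using ci by (simp add: central_idempotentD)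
  also have "\<dots> = z'" using *[OF assms(2) ci(1)] assms by simp
  finally show ?thesis .
qed

text \<open>Centrality reduces the action on the left ideal to the action on its generator. The
  generator lies in the ideal itself, which lets uniqueness be tested on it.\<close>

lemma irrep_idempotent_eqI:
  assumes z: "primitive_central_idempotent n z" and zc: "ga_mult n z (young_symmetrizer n lam) = young_symmetrizer n lam"
    and c0: "young_symmetrizer n lam \<noteq> 0"
  shows "irrep_idempotent n lam = z"
  unfolding irrep_idempotent_def
proof (rule the_equality, intro conjI ballI)
  show "primitive_central_idempotent n z" by (rule z)
  fix v assume "v \<in> specht_module n lam"
  then obtain x where x: "x \<in> group_algebra n" "v = ga_mult n x (young_symmetrizer n lam)"
    by (auto simp: specht_module_def)
  have "central_idempotent n z" using z by (simp add: primitive_central_idempotent_def)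
  from central_idempotentD(3)[OF this x(1)] show "ga_mult n z v = v"
    by (metis x(2) zc ga_mult_assoc)
next
  fix z' assume z': "primitive_central_idempotent n z' \<and> (\<forall>v\<in>specht_module n lam. ga_mult n z' v = v)"
  have "young_symmetrizer n lam \<in> specht_module n lam"
    unfolding specht_module_def
    by (rule image_eqI[of _ _ "ga_of id"]) (simp_all add: young_symmetrizer_def)
  with z' have "ga_mult n z' (young_symmetrizer n lam) = young_symmetrizer n lam" by blast
  then show "z' = z"
    using z' z zc c0 primitive_central_idempotent_unique by metis
qed

subsection \<open>Young symmetrizers of hooks\<close>

declare One_nat_def [simp del]

text \<open>The complements of \<open>F\<close> and of its image have equal size, so any bijection
  between them completes \<open>f\<close>. It supplies permutations with a few prescribed
  values.\<close>

lemma permutes_extension: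
  assumes "finite S" "F \<subseteq> S" "f ` F \<subseteq> S" "inj_on f F"
  obtains p where "p permutes S" "\<And>x. x \<in> F \<Longrightarrow> p x = f x"
proof -
  have "card (S - F) = card (S - f ` F)"
    using assms by (simp add: card_Diff_subset card_image finite_subset)
  then obtain g where g: "bij_betw g (S - F) (S - f ` F)"
    using assms(1) finite_same_card_bij[of "S - F" "S - f ` F"] by auto
  define p where "p x = (if x \<in> F then f x else if x \<in> S then g x else x)" for x
  have "bij_betw p F (f ` F)"
    using assms(4) by (auto simp: bij_betw_def p_def inj_on_def)
  moreover have "bij_betw p (S - F) (S - f ` F)"
    using g by (rule bij_betw_cong[THEN iffD1, rotated]) (simp add: p_def)
  ultimately have "bij_betw p (F \<union> (S - F)) (f ` F \<union> (S - f ` F))"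
    by (rule bij_betw_combine) auto
  moreover have "F \<union> (S - F) = S" "f ` F \<union> (S - f ` F) = S" using assms by auto
  ultimately have "p permutes S"
    using assms(2) by (intro bij_imp_permutes) (auto simp: p_def)
  thus thesis by (rule that) (simp add: p_def)
qed

lemma permutes_in_Sym: "\<sigma> permutes X \<Longrightarrow> X \<subseteq> {1..n} \<Longrightarrow> \<sigma> \<in> Sym n"
  by (simp add: Sym_def permutes_subset)

lemma permutes_subset_eq:
  assumes "X \<subseteq> {1..n}"
  shows "{\<sigma>. \<sigma> permutes X} = {\<sigma> \<in> Sym n. \<forall>i\<in>{1..n} - X. \<sigma> i = i}"
  using assms permutes_superset[of _ "{1..n}" X]
  by (auto simp: Sym_def permutes_subset permutes_not_in)

section \<open>Row sums and signed column sums of two sets of cells\<close>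

definition row_sum :: "nat set \<Rightarrow> ga" where
  "row_sum X = (\<Sum>\<sigma> | \<sigma> permutes X. ga_of \<sigma>)"

definition col_sum :: "nat set \<Rightarrow> ga" where
  "col_sum Y = (\<Sum>\<sigma> | \<sigma> permutes Y. ga_scale (of_int (sign \<sigma>)) (ga_of \<sigma>))"

lemma row_sum_apply: "finite X \<Longrightarrow> row_sum X \<sigma> = (if \<sigma> permutes X then 1 else 0)"
  by (simp add: row_sum_def sum_fun_apply finite_permutations)

lemma col_sum_apply: "finite Y \<Longrightarrow> col_sum Y \<sigma> = (if \<sigma> permutes Y then of_int (sign \<sigma>) else 0)"
  by (simp add: col_sum_def sum_fun_apply finite_permutations if_distrib[of "(*) _"] cong: if_cong)

text \<open>Absorption happens on the right here and on the left for \<open>col_sum\<close>: these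
  are the inner sides of \<open>row_sum X\<close> times \<open>col_sum Y\<close>, facing a group
  element placed between the factors.\<close>

lemma row_sum_absorb:
  assumes "p permutes X" "X \<subseteq> {1..n}"
  shows "ga_mult n (row_sum X) (ga_of p) = row_sum X"
proof -
  have "ga_mult n (row_sum X) (ga_of p) = (\<Sum>\<sigma> | \<sigma> permutes X. ga_of (p \<circ> \<sigma>))"
    unfolding row_sum_def ga_mult_sum_left
    using assms by (intro sum.cong refl) (auto simp: ga_of_mult_ga_of permutes_in_Sym)
  also have "\<dots> = row_sum X"
    unfolding row_sum_def by (rule setum_permutations_compose_left[OF assms(1), symmetric])
  finally show ?thesis .
qed

lemma col_sum_absorb:
  assumes "q permutes Y" "Y \<subseteq> {1..n}"
  shows "ga_mult n (ga_of q) (col_sum Y) = ga_scale (of_int (sign q)) (col_sum Y)"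
proof -
  have Y: "finite Y" using assms(2) finite_subset by blast
  have "ga_mult n (ga_of q) (col_sum Y) =
      (\<Sum>\<sigma> | \<sigma> permutes Y. ga_scale (of_int (sign q)) (ga_scale (of_int (sign (\<sigma> \<circ> q))) (ga_of (\<sigma> \<circ> q))))"
    unfolding col_sum_def ga_mult_sum_right
  proof (intro sum.cong refl)
    fix \<sigma> assume "\<sigma> \<in> {\<sigma>. \<sigma> permutes Y}"
    hence \<sigma>: "\<sigma> permutes Y" by simp
    have "sign (\<sigma> \<circ> q) = sign \<sigma> * sign q"
      using \<sigma> assms(1) Y by (intro sign_compose) (auto simp: permutation_permutes)
    hence "sign q * sign (\<sigma> \<circ> q) = sign \<sigma>" by simp
    hence "(of_int (sign q) * of_int (sign (\<sigma> \<circ> q)) :: complex) = of_int (sign \<sigma>)"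
      by (simp flip: of_int_mult)
    thus "ga_mult n (ga_of q) (ga_scale (of_int (sign \<sigma>)) (ga_of \<sigma>)) =
      ga_scale (of_int (sign q)) (ga_scale (of_int (sign (\<sigma> \<circ> q))) (ga_of (\<sigma> \<circ> q)))"
      using \<sigma> assms by (simp add: ga_mult_linear ga_of_mult_ga_of permutes_in_Sym)
  qed
  also have "\<dots> = ga_scale (of_int (sign q)) (col_sum Y)"
    unfolding col_sum_def ga.scale_sum_right[symmetric]
    by (simp only: sum_permutations_compose_right[OF assms(1),
          of "\<lambda>\<sigma>. ga_scale (of_int (sign \<sigma>)) (ga_of \<sigma>)"])
  finally show ?thesis .
qed

text \<open>The transposition of \<open>u\<close> and \<open>v\<close> is absorbed by the row sum.
  Moved across \<open>\<sigma>\<close> it becomes the transposition of \<open>\<sigma> u\<close> and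
  \<open>\<sigma> v\<close>, which the column sum absorbs with sign -1. The product is its own
  negative.\<close>

lemma row_col_vanish:
  assumes XY: "X \<subseteq> {1..n}" "Y \<subseteq> {1..n}" and \<sigma>: "\<sigma> \<in> Sym n"
    and uv: "u \<in> X" "v \<in> X" "u \<noteq> v" "\<sigma> u \<in> Y" "\<sigma> v \<in> Y"
  shows "ga_mult n (row_sum X) (ga_mult n (ga_of \<sigma>) (col_sum Y)) = 0"
proof -
  let ?w = "ga_mult n (row_sum X) (ga_mult n (ga_of \<sigma>) (col_sum Y))"
  let ?t = "transpose u v" and ?t' = "transpose (\<sigma> u) (\<sigma> v)"
  have t: "?t permutes X" "?t' permutes Y" using uv by (auto intro: permutes_swap_id)
  have tS: "?t \<in> Sym n" "?t' \<in> Sym n" using t XY by (auto intro: permutes_in_Sym)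
  have ne: "\<sigma> u \<noteq> \<sigma> v" using \<sigma> uv by (simp add: inj_Sym)
  have comm: "\<sigma> \<circ> ?t = ?t' \<circ> \<sigma>"
    using \<sigma> by (auto simp: fun_eq_iff transpose_def inj_Sym)
  have "?w = ga_mult n (ga_mult n (row_sum X) (ga_of ?t)) (ga_mult n (ga_of \<sigma>) (col_sum Y))"
    by (simp add: row_sum_absorb t XY)
  also have "\<dots> = ga_mult n (row_sum X) (ga_mult n (ga_of (\<sigma> \<circ> ?t)) (col_sum Y))"
    using \<sigma> tS by (simp add: ga_mult_assoc flip: ga_of_mult_ga_of)
  also have "\<dots> = ga_mult n (row_sum X) (ga_mult n (ga_of \<sigma>) (ga_mult n (ga_of ?t') (col_sum Y)))"
    using \<sigma> tS by (simp add: comm ga_mult_assoc flip: ga_of_mult_ga_of)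
  also have "\<dots> = ga_scale (-1) ?w"
    using t XY ne by (simp add: col_sum_absorb ga_mult_linear sign_swap_id)
  finally have w: "?w = ga_scale (-1) ?w" .
  have "?w \<rho> = 0" for \<rho> using fun_cong[OF w, of \<rho>] by simp
  thus ?thesis by (simp add: fun_eq_iff)
qed

text \<open>The counterpart of the vanishing case. Since at most one point of \<open>X\<close> goes
  to \<open>Y\<close>, the others fill \<open>X - {b}\<close> by counting. One transposition inside
  \<open>Y\<close> then carries the image of \<open>X\<close> back to \<open>X\<close>.\<close>

lemma row_col_factor:
  assumes XY: "X \<union> Y = {1..n}" "X \<inter> Y = {b}" and \<sigma>: "\<sigma> \<in> Sym n"
    and inj: "\<And>u v. u \<in> X \<Longrightarrow> v \<in> X \<Longrightarrow> \<sigma> u \<in> Y \<Longrightarrow> \<sigma> v \<in> Y \<Longrightarrow> u = v"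
  obtains p q where "p permutes X" "q permutes Y" "\<sigma> = q \<circ> p"
proof -
  have fin: "finite X" "finite Y" using XY finite_subset[of _ "{1..n}"] by auto
  have inj\<sigma>: "inj \<sigma>" using \<sigma> by (simp add: inj_def inj_Sym)
  have img: "\<sigma> ` X \<subseteq> {1..n}" using \<sigma> XY by (auto simp del: atLeastAtMost_iff)
  have 1: "\<sigma> ` X - Y \<subseteq> X - {b}" using img XY by blast
  have "card (\<sigma> ` X \<inter> Y) \<le> 1"
  proof (rule card_le_Suc0_iff_eq[THEN iffD2, simplified One_nat_def[symmetric]])
    show "\<forall>a\<in>\<sigma> ` X \<inter> Y. \<forall>b\<in>\<sigma> ` X \<inter> Y. a = b" using inj by blast
  qed (use fin in simp)
  moreover have "card (\<sigma> ` X) = card (\<sigma> ` X - Y) + card (\<sigma> ` X \<inter> Y)"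
    using fin by (metis card_Diff_subset_Int card_mono Int_lower1 finite_Int finite_imageI le_add_diff_inverse2)
  moreover have "card (\<sigma> ` X) = card X" using inj\<sigma> by (simp add: card_image inj_on_subset)
  moreover have "card (\<sigma> ` X - Y) \<le> card (X - {b})" using 1 fin by (simp add: card_mono)
  moreover have "card (X - {b}) = card X - 1" "card X > 0"
    using XY(2) fin by (auto simp: card_gt_0_iff intro!: card_Diff_singleton)
  ultimately have c: "card (\<sigma> ` X - Y) = card (X - {b})" "card (\<sigma> ` X \<inter> Y) = 1" by linarith+
  have 2: "\<sigma> ` X - Y = X - {b}" using c(1) 1 fin by (intro card_subset_eq) auto
  obtain y where y: "\<sigma> ` X \<inter> Y = {y}" using c(2) by (rule card_1_singletonE)
  have \<sigma>X: "\<sigma> ` X = insert y (X - {b})" using 2 y by blast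
  \<comment> \<open>\<open>y\<close> is the single point of the image of \<open>X\<close> lying in
    \<open>Y\<close>; swapping it with the corner \<open>b\<close> restores
    \<open>X\<close>.\<close>
  let ?t = "transpose b y"
  have t: "?t permutes Y" using y XY by (intro permutes_swap_id) auto
  have tfix: "?t i = i" if "i \<in> X - {b}" for i
    using that y XY by (auto simp: transpose_def)
  have "(?t \<circ> \<sigma>) ` X = insert b (X - {b})"
    unfolding image_comp[symmetric] \<sigma>X using tfix by (auto simp: image_iff)
  also have "\<dots> = X" using XY by auto
  finally have bij: "bij_betw (?t \<circ> \<sigma>) X X"
    unfolding bij_betw_def using inj_compose[OF inj_transpose inj\<sigma>]
    by (blast intro: inj_on_subset)
  define p where "p = restrict_id (?t \<circ> \<sigma>) X"
  have p: "p permutes X" unfolding p_def by (rule permutes_restrict_id[OF bij])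
  have pX: "p i = ?t (\<sigma> i)" if "i \<in> X" for i using that by (simp add: p_def)
  have "p \<in> Sym n" using p XY by (intro permutes_in_Sym) auto
  have "\<sigma> \<circ> inv p permutes Y"
  proof (rule permutes_superset)
    show "\<sigma> \<circ> inv p permutes {1..n}"
      using comp_in_Sym[OF \<sigma> inv_in_Sym[OF \<open>p \<in> Sym n\<close>]] by (simp add: Sym_def)
    \<comment> \<open>On \<open>X\<close> the map \<open>\<sigma> \<circ> inv p\<close> agrees with
      \<open>?t\<close>, and \<open>?t\<close> fixes every point of \<open>X\<close> other than
      \<open>b\<close> and \<open>y\<close>, both of which lie in \<open>Y\<close>.\<close>
    fix i assume "i \<in> {1..n} - Y"
    hence i: "i \<in> X - {b}" using XY by auto
    define x where "x = inv p i"
    have x: "x \<in> X" "p x = i"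
      using i p by (auto simp: x_def permutes_inverses permutes_in_image[OF permutes_inv[OF p]])
    have "\<sigma> x = ?t (?t (\<sigma> x))" by simp
    also have "\<dots> = i" using x pX[of x] tfix[OF i] by simp
    finally show "(\<sigma> \<circ> inv p) i = i" by (simp add: x_def)
  qed
  thus thesis using \<open>p \<in> Sym n\<close> p by (intro that[of p "\<sigma> \<circ> inv p"]) (auto simp: fun_eq_iff)
qed

text \<open>For a group element in the middle there are two cases: it sends two points of
  \<open>X\<close> to \<open>Y\<close> and the product vanishes, or it factors into a row and a
  column permutation, which are absorbed up to a sign.\<close>

lemma row_col_primitive:
  assumes XY: "X \<union> Y = {1..n}" "X \<inter> Y = {b}" and "x \<in> group_algebra n"
  shows "\<exists>k. ga_mult n (row_sum X) (ga_mult n x (col_sum Y)) =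
    ga_scale k (ga_mult n (row_sum X) (col_sum Y))"
proof -
  let ?c = "ga_mult n (row_sum X) (col_sum Y)"
  have sub: "X \<subseteq> {1..n}" "Y \<subseteq> {1..n}" using XY by auto
  have "\<exists>k. ga_mult n (row_sum X) (ga_mult n (ga_of \<sigma>) (col_sum Y)) = ga_scale k ?c"
    if \<sigma>: "\<sigma> \<in> Sym n" for \<sigma>
  proof (cases "\<exists>u v. u \<in> X \<and> v \<in> X \<and> \<sigma> u \<in> Y \<and> \<sigma> v \<in> Y \<and> u \<noteq> v")
    case True
    then obtain u v where "u \<in> X" "v \<in> X" "\<sigma> u \<in> Y" "\<sigma> v \<in> Y" "u \<noteq> v" by blast
    from row_col_vanish[OF sub \<sigma> this(1,2,5,3,4)] show ?thesis
      by (intro exI[of _ 0]) simp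
  next
    case False
    then obtain p q where pq: "p permutes X" "q permutes Y" "\<sigma> = q \<circ> p"
      using row_col_factor[OF XY \<sigma>] by metis
    have "p \<in> Sym n" "q \<in> Sym n" using pq sub by (auto intro: permutes_in_Sym)
    hence "ga_mult n (row_sum X) (ga_mult n (ga_of \<sigma>) (col_sum Y)) =
        ga_mult n (ga_mult n (row_sum X) (ga_of p)) (ga_mult n (ga_of q) (col_sum Y))"
      by (simp add: pq(3) ga_mult_assoc flip: ga_of_mult_ga_of)
    also have "\<dots> = ga_scale (of_int (sign q)) ?c"
      using pq sub by (simp add: row_sum_absorb col_sum_absorb ga_mult_linear)
    finally show ?thesis by blast
  qed
  then obtain k where k: "\<And>\<sigma>. \<sigma> \<in> Sym n \<Longrightarrow>
      ga_mult n (row_sum X) (ga_mult n (ga_of \<sigma>) (col_sum Y)) = ga_scale (k \<sigma>) ?c" by metis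
  have "ga_mult n (row_sum X) (ga_mult n x (col_sum Y)) = (\<Sum>\<sigma>\<in>Sym n. ga_scale (x \<sigma>) (ga_scale (k \<sigma>) ?c))"
    by (subst ga_expand[OF assms(3)]) (simp add: ga_mult_linear k cong: sum.cong)
  also have "\<dots> = ga_scale (\<Sum>\<sigma>\<in>Sym n. x \<sigma> * k \<sigma>) ?c"
    by (simp add: ga.scale_sum_left)
  finally show ?thesis by blast
qed

text \<open>The summand at \<open>\<tau>\<close> survives when
  \<open>inv \<tau> \<circ> \<rho>\<close> is a row permutation, that is, fixes every point off
  \<open>X\<close>. For a short leg the coefficient therefore depends on very few values of
  \<open>\<rho>\<close>.\<close>

lemma row_col_apply:
  assumes XY: "X \<subseteq> {1..n}" "Y \<subseteq> {1..n}" and \<rho>: "\<rho> \<in> Sym n"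
  shows "ga_mult n (row_sum X) (col_sum Y) \<rho> =
    (\<Sum>\<tau> | \<tau> permutes Y. if \<forall>i\<in>{1..n} - X. \<rho> i = \<tau> i then of_int (sign \<tau>) else 0)"
proof -
  have fin: "finite X" "finite Y" using XY finite_subset by blast+
  have "ga_mult n (row_sum X) (col_sum Y) \<rho> = (\<Sum>\<tau>\<in>Sym n. row_sum X (inv \<tau> \<circ> \<rho>) * col_sum Y \<tau>)"
    by (rule ga_mult_apply_left[OF \<rho>])
  also have "\<dots> = (\<Sum>\<tau> | \<tau> permutes Y. row_sum X (inv \<tau> \<circ> \<rho>) * col_sum Y \<tau>)"
    using XY by (intro sum.mono_neutral_right) (auto simp: permutes_in_Sym col_sum_apply[OF fin(2)])
  also have "\<dots> = (\<Sum>\<tau> | \<tau> permutes Y. if \<forall>i\<in>{1..n} - X. \<rho> i = \<tau> i then of_int (sign \<tau>) else 0)"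
  proof (intro sum.cong refl)
    fix \<tau> assume "\<tau> \<in> {\<tau>. \<tau> permutes Y}"
    hence \<tau>: "\<tau> permutes Y" "\<tau> \<in> Sym n" using XY by (auto intro: permutes_in_Sym)
    have "inv \<tau> \<circ> \<rho> \<in> Sym n" using \<tau> \<rho> by simp
    moreover have "inv \<tau> (\<rho> i) = i \<longleftrightarrow> \<rho> i = \<tau> i" for i using \<tau>(2) by (metis inv_o_Sym(3,4))
    ultimately have "inv \<tau> \<circ> \<rho> permutes X \<longleftrightarrow> (\<forall>i\<in>{1..n} - X. \<rho> i = \<tau> i)"
      using permutes_subset_eq[OF XY(1)] by (auto simp: set_eq_iff)
    thus "row_sum X (inv \<tau> \<circ> \<rho>) * col_sum Y \<tau> =
        (if \<forall>i\<in>{1..n} - X. \<rho> i = \<tau> i then of_int (sign \<tau>) else 0)"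
      using \<tau> by (simp add: row_sum_apply fin col_sum_apply)
  qed
  finally show ?thesis .
qed

text \<open>The coefficient at the identity is 1: a column permutation that fixes all points off
  \<open>X\<close> can move only \<open>b\<close>, hence nothing.\<close>

lemma row_col_nonzero:
  assumes XY: "X \<subseteq> {1..n}" "Y \<subseteq> {1..n}" "X \<inter> Y = {b}"
  shows "ga_mult n (row_sum X) (col_sum Y) \<noteq> 0"
proof -
  have "\<tau> = id" if \<tau>: "\<tau> permutes Y" "\<forall>i\<in>{1..n} - X. i = \<tau> i" for \<tau>
  proof -
    have "\<tau> permutes {b}"
    proof (rule permutes_superset[OF \<tau>(1)])
      fix x assume "x \<in> Y - {b}"
      hence "x \<in> {1..n} - X" using XY by blast
      thus "\<tau> x = x" using \<tau>(2) by metis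
    qed
    thus ?thesis by simp
  qed
  hence "ga_mult n (row_sum X) (col_sum Y) id =
     (\<Sum>\<tau> | \<tau> permutes Y. if \<tau> = id then 1 else 0)"
    unfolding row_col_apply[OF XY(1,2) id_in_Sym]
    by (intro sum.cong refl) (auto simp del: atLeastAtMost_iff)
  also have "\<dots> = 1" using XY(2) finite_subset by (subst sum.delta) (auto intro!: finite_permutations)
  finally show ?thesis by auto
qed

section \<open>The tableau of a hook with arm row \<open>{1..m}\<close> and \<open>k\<close> further
  cells in the first column\<close>

lemma tableau_entry_hook:
  "tableau_entry (m # replicate k 1) 0 c = c + 1"
  "r < k \<Longrightarrow> tableau_entry (m # replicate k 1) (Suc r) c = m + Suc r + c"
  by (simp_all add: tableau_entry_def sum_list_replicate)

lemma tableau_row_hook: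
  "tableau_row (m # replicate k 1) 0 = {1..m}"
  "tableau_row (m # replicate k 1) (Suc r) = (if r < k then {m + Suc r} else {})"
proof -
  have "x \<in> {1..m} \<longleftrightarrow> (\<exists>c. x = c + 1 \<and> c < m)" for x by (cases x) auto
  thus "tableau_row (m # replicate k 1) 0 = {1..m}"
    by (auto simp: tableau_row_def tableau_entry_hook)
  show "tableau_row (m # replicate k 1) (Suc r) = (if r < k then {m + Suc r} else {})"
    by (auto simp: tableau_row_def tableau_entry_hook)
qed

lemma tableau_col_hook:
  assumes "m \<ge> 1"
  shows "tableau_col (m # replicate k 1) 0 = insert 1 {m + 1..m + k}"
    "tableau_col (m # replicate k 1) (Suc c) = (if Suc c < m then {c + 2} else {})"
proof -
  have eq: "tableau_col (m # replicate k 1) c =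
    {x. (x = c + 1 \<and> c < m) \<or> (\<exists>r. x = m + Suc r + c \<and> r < k \<and> c < 1)}" for c
  proof (intro set_eqI iffI)
    fix x assume "x \<in> tableau_col (m # replicate k 1) c"
    then obtain r where r: "r < Suc k" "c < (m # replicate k 1) ! r" "x = tableau_entry (m # replicate k 1) r c"
      by (auto simp: tableau_col_def)
    thus "x \<in> {x. (x = c + 1 \<and> c < m) \<or> (\<exists>r. x = m + Suc r + c \<and> r < k \<and> c < 1)}"
      by (cases r) (auto simp: tableau_entry_hook)
  next
    fix x assume "x \<in> {x. (x = c + 1 \<and> c < m) \<or> (\<exists>r. x = m + Suc r + c \<and> r < k \<and> c < 1)}"
    then consider "x = c + 1" "c < m" | r where "x = m + Suc r + c" "r < k" "c < 1" by auto
    thus "x \<in> tableau_col (m # replicate k 1) c"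
    proof cases
      case 1
      thus ?thesis unfolding tableau_col_def
        by (intro CollectI exI[of _ 0]) (simp add: tableau_entry_hook)
    next
      case 2
      thus ?thesis unfolding tableau_col_def
        by (intro CollectI exI[of _ "Suc r"]) (simp add: tableau_entry_hook)
    qed
  qed
  have "x \<in> {m + 1..m + k} \<longleftrightarrow> (\<exists>r. x = m + Suc r \<and> r < k)" for x
    by (auto intro: exI[of _ "x - Suc m"])
  thus "tableau_col (m # replicate k 1) 0 = insert 1 {m + 1..m + k}"
    using assms unfolding eq by auto
  show "tableau_col (m # replicate k 1) (Suc c) = (if Suc c < m then {c + 2} else {})"
    unfolding eq by auto
qed

lemma permutes_iff_image_fix:
  assumes "X \<subseteq> {1..n}"
  shows "\<sigma> permutes X \<longleftrightarrow> \<sigma> \<in> Sym n \<and> \<sigma> ` X = X \<and> (\<forall>i\<in>{1..n} - X. \<sigma> i = i)"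
proof
  assume "\<sigma> permutes X"
  thus "\<sigma> \<in> Sym n \<and> \<sigma> ` X = X \<and> (\<forall>i\<in>{1..n} - X. \<sigma> i = i)"
    using assms by (simp add: permutes_in_Sym permutes_image permutes_not_in)
next
  assume "\<sigma> \<in> Sym n \<and> \<sigma> ` X = X \<and> (\<forall>i\<in>{1..n} - X. \<sigma> i = i)"
  thus "\<sigma> permutes X" using permutes_subset_eq[OF assms] by blast
qed

lemma image_singleton_if:
  "\<sigma> ` (if P then {a} else {}) = (if P then {a} else {}) \<longleftrightarrow> (P \<longrightarrow> \<sigma> a = a)"
  by auto

text \<open>Every row below the first has one cell or none, so preserving it means fixing that cell;
  nothing but the first row remains to be permuted.\<close>

lemma row_group_hook: "row_group (m + k) (m # replicate k 1) = {\<sigma>. \<sigma> permutes {1..m}}"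
proof -
  have all_nat: "(\<forall>r. P r) \<longleftrightarrow> P 0 \<and> (\<forall>r. P (Suc r))" for P :: "nat \<Rightarrow> bool"
    by (metis not0_implies_Suc)
  have *: "i \<in> {1..m + k} - {1..m} \<longleftrightarrow> (\<exists>r<k. i = m + Suc r)" for i
    by (auto intro: exI[of _ "i - Suc m"])
  have "(\<forall>i\<in>{1..m + k} - {1..m}. \<sigma> i = i) \<longleftrightarrow> (\<forall>r<k. \<sigma> (m + Suc r) = m + Suc r)" for \<sigma>
    unfolding Ball_def * by blast
  hence "\<sigma> \<in> row_group (m + k) (m # replicate k 1) \<longleftrightarrow> \<sigma> permutes {1..m}" for \<sigma>
    unfolding row_group_def mem_Collect_eq
      all_nat[of "\<lambda>r. \<sigma> ` tableau_row (m # replicate k 1) r = tableau_row (m # replicate k 1) r"]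
      tableau_row_hook image_singleton_if
    by (subst permutes_iff_image_fix[of "{1..m}" "m + k"]) simp_all
  thus ?thesis by blast
qed

lemma col_group_hook:
  assumes "m \<ge> 1"
  shows "col_group (m + k) (m # replicate k 1) = {\<sigma>. \<sigma> permutes insert 1 {m + 1..m + k}}"
proof -
  have all_nat: "(\<forall>r. P r) \<longleftrightarrow> P 0 \<and> (\<forall>r. P (Suc r))" for P :: "nat \<Rightarrow> bool"
    by (metis not0_implies_Suc)
  have *: "i \<in> {1..m + k} - insert 1 {m + 1..m + k} \<longleftrightarrow> (\<exists>c. Suc c < m \<and> i = c + 2)" for i
    by (auto intro: exI[of _ "i - 2"])
  have "(\<forall>i\<in>{1..m + k} - insert 1 {m + 1..m + k}. \<sigma> i = i) \<longleftrightarrow> (\<forall>c. Suc c < m \<longrightarrow> \<sigma> (c + 2) = c + 2)" for \<sigma>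
    unfolding Ball_def * by blast
  hence "\<sigma> \<in> col_group (m + k) (m # replicate k 1) \<longleftrightarrow> \<sigma> permutes insert 1 {m + 1..m + k}" for \<sigma>
    unfolding col_group_def mem_Collect_eq
      all_nat[of "\<lambda>r. \<sigma> ` tableau_col (m # replicate k 1) r = tableau_col (m # replicate k 1) r"]
      tableau_col_hook[OF assms] image_singleton_if
    using assms by (subst permutes_iff_image_fix[of "insert 1 {m + 1..m + k}" "m + k"]) simp_all
  thus ?thesis by blast
qed

lemma young_symmetrizer_hook:
  assumes "m \<ge> 1"
  shows "young_symmetrizer (m + k) (m # replicate k 1) =
    ga_mult (m + k) (row_sum {1..m}) (col_sum (insert 1 {m + 1..m + k}))"
  by (simp only: young_symmetrizer_def row_group_hook col_group_hook[OF assms] row_sum_def col_sum_def)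

text \<open>In \<open>c x c\<close> the column sum, \<open>x\<close> and the row sum together form
  the middle of a row-column product, so \<open>row_col_primitive\<close> gives primitivity. The
  explicit multiple of \<open>conj_sum\<close> is kept in order to compute products with other
  symmetrizers.\<close>

lemma irrep_idempotent_hook:
  fixes m k :: nat
  assumes "m \<ge> 1"
  defines "n \<equiv> m + k" and "lam \<equiv> m # replicate k 1"
  defines "c \<equiv> young_symmetrizer n lam"
  obtains s where "irrep_idempotent n lam = ga_scale s (conj_sum n (ga_mult n c (ga_adj n c)))"
    "central_idempotent n (irrep_idempotent n lam)" "ga_mult n (irrep_idempotent n lam) c = c"
proof -
  let ?X = "{1..m}" and ?Y = "insert 1 {m + 1..m + k}"
  have XY: "?X \<union> ?Y = {1..n}" "?X \<inter> ?Y = {1}" using assms(1) by (auto simp: n_def)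
  have c: "c = ga_mult n (row_sum ?X) (col_sum ?Y)"
    unfolding c_def n_def lam_def by (rule young_symmetrizer_hook[OF assms(1)])
  have c0: "c \<noteq> 0" unfolding c by (rule row_col_nonzero[of _ _ _ 1]) (use XY in auto)
  have "\<exists>k. ga_mult n c (ga_mult n x c) = ga_scale k c" if "x \<in> group_algebra n" for x
    using row_col_primitive[OF XY, of "ga_mult n (col_sum ?Y) (ga_mult n x (row_sum ?X))"]
    unfolding c by (simp add: ga_mult_assoc)
  from primitive_central_idempotent_exists[OF _ c0 this]
  obtain s where s: "primitive_central_idempotent n (ga_scale s (conj_sum n (ga_mult n c (ga_adj n c))))"
    "ga_mult n (ga_scale s (conj_sum n (ga_mult n c (ga_adj n c)))) c = c"
    by (auto simp: c)
  have "irrep_idempotent n lam = ga_scale s (conj_sum n (ga_mult n c (ga_adj n c)))"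
    using s c0 by (intro irrep_idempotent_eqI) (simp_all add: c_def)
  with s show thesis by (intro that[of s]) (auto simp: primitive_central_idempotent_def)
qed

subsection \<open>The idempotents of the diagrams \<open>(n-1,1)\<close> and \<open>(n-2,1,1)\<close>\<close>

lemma translate_apply:
  assumes "\<sigma> \<in> Sym n" "\<tau> \<in> Sym n" "\<rho> \<in> Sym n"
  shows "ga_mult n (ga_of \<sigma>) (ga_mult n x (ga_of \<tau>)) \<rho> = x (inv \<tau> \<circ> \<rho> \<circ> inv \<sigma>)"
  using assms by (simp add: ga_of_mult_apply mult_ga_of_apply o_assoc)

text \<open>A central \<open>z\<close> passes the left factor, and the right factor is out of its
  way. Only the scalars 0 and 1 occur in the applications.\<close>

lemma translate_eigen:
  assumes z: "central_idempotent n z" and zc: "ga_mult n z c = ga_scale s c" and "\<sigma> \<in> Sym n"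
  shows "ga_mult n z (ga_mult n (ga_of \<sigma>) (ga_mult n c (ga_of \<tau>))) =
    ga_scale s (ga_mult n (ga_of \<sigma>) (ga_mult n c (ga_of \<tau>)))"
proof -
  have "ga_mult n z (ga_mult n (ga_of \<sigma>) (ga_mult n c (ga_of \<tau>))) =
      ga_mult n (ga_mult n z (ga_of \<sigma>)) (ga_mult n c (ga_of \<tau>))" by (simp add: ga_mult_assoc)
  also have "\<dots> = ga_mult n (ga_of \<sigma>) (ga_mult n (ga_mult n z c) (ga_of \<tau>))"
    using central_idempotentD(3)[OF z ga_of_closed[OF assms(3)]] by (simp add: ga_mult_assoc)
  finally show ?thesis by (simp add: zc ga_mult_linear)
qed

text \<open>The matrix coefficients of the natural permutation representation on n points.\<close>

definition pos_ind :: "nat \<Rightarrow> nat \<Rightarrow> nat \<Rightarrow> ga" where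
  "pos_ind n i k = (\<lambda>\<sigma>. if \<sigma> \<in> Sym n \<and> \<sigma> i = k then 1 else 0)"

text \<open>The determinant with rows \<open>(1,1,1)\<close>, \<open>([\<sigma> i = p], [\<sigma> i = q], [\<sigma> i = r])\<close> and
  \<open>([\<sigma> j = p], [\<sigma> j = q], [\<sigma> j = r])\<close>.\<close>

definition pos_minor :: "nat \<Rightarrow> nat \<Rightarrow> nat \<Rightarrow> nat \<Rightarrow> nat \<Rightarrow> nat \<Rightarrow> ga" where
  "pos_minor n i j p q r = (\<lambda>\<sigma>. if \<sigma> \<in> Sym n then
     of_bool (\<sigma> i = p) * of_bool (\<sigma> j = q) - of_bool (\<sigma> i = q) * of_bool (\<sigma> j = p) +
     of_bool (\<sigma> i = q) * of_bool (\<sigma> j = r) - of_bool (\<sigma> i = r) * of_bool (\<sigma> j = q) +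
     of_bool (\<sigma> i = r) * of_bool (\<sigma> j = p) - of_bool (\<sigma> i = p) * of_bool (\<sigma> j = r) else 0)"

lemma pos_ind_apply: "\<sigma> \<in> Sym n \<Longrightarrow> pos_ind n i k \<sigma> = of_bool (\<sigma> i = k)"
  by (simp add: pos_ind_def)

lemma pos_minor_apply:
  "\<sigma> \<in> Sym n \<Longrightarrow> pos_minor n i j p q r \<sigma> =
     of_bool (\<sigma> i = p) * of_bool (\<sigma> j = q) - of_bool (\<sigma> i = q) * of_bool (\<sigma> j = p) +
     of_bool (\<sigma> i = q) * of_bool (\<sigma> j = r) - of_bool (\<sigma> i = r) * of_bool (\<sigma> j = q) +
     of_bool (\<sigma> i = r) * of_bool (\<sigma> j = p) - of_bool (\<sigma> i = p) * of_bool (\<sigma> j = r)"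
  by (simp add: pos_minor_def)

lemma pos_closed [simp]: "pos_ind n i k \<in> group_algebra n" "pos_minor n i j p q r \<in> group_algebra n"
  by (auto simp: group_algebra_def pos_ind_def pos_minor_def)

text \<open>Only \<open>n\<close> lies off the row, so the coefficient depends on the value at
  \<open>n\<close> alone: the identity contributes for value \<open>n\<close>, the transposition
  with sign -1 for value 1.\<close>

lemma young_symmetrizer_hook1:
  assumes "n \<ge> 2"
  shows "young_symmetrizer n [n - 1, 1] = pos_ind n n n - pos_ind n n 1"
proof -
  have n: "n - 1 + 1 = n" using assms by simp
  have Y: "insert 1 {n - 1 + 1..n - 1 + 1} = {1, n}" using assms by auto
  have ys: "young_symmetrizer n [n - 1, 1] = ga_mult n (row_sum {1..n - 1}) (col_sum {1, n})"
    using young_symmetrizer_hook[of "n - 1" 1] assms unfolding Y n by (simp add: One_nat_def)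
  have rest: "{1..n} - {1..n - 1} = {n}" using assms by auto
  have perms: "{\<tau>. \<tau> permutes {1, n}} = {id, transpose 1 n}"
    by (auto simp: permutes_doubleton_iff)
  have "id \<noteq> transpose 1 n" using assms by (metis id_apply transpose_apply_first One_nat_def Suc_1 not_less_eq_eq order_refl)
  thus ?thesis
    unfolding ys using assms
    by (intro group_algebra_eqI[of _ n])
      (simp_all add: row_col_apply rest perms sign_swap_id pos_ind_apply)
qed

text \<open>The six permutations, enumerated as cosets of the group of
  \<open>{b, c}\<close>.\<close>

lemma sum_permutes_triple:
  assumes "a \<noteq> b" "a \<noteq> c" "b \<noteq> c"
  shows "(\<Sum>\<tau> | \<tau> permutes {a, b, c}. f \<tau>) =
    f id + f (transpose b c) + (f (transpose a b) + f (transpose a b \<circ> transpose b c)) +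
    (f (transpose a c) + f (transpose a c \<circ> transpose b c))"
proof -
  have "{\<tau>. \<tau> permutes {c}} = {id}" by auto
  hence bc: "(\<Sum>\<tau> | \<tau> permutes {b, c}. g \<tau>) = g id + g (transpose b c)" for g :: "_ \<Rightarrow> 'b"
    using assms by (subst sum_over_permutations_insert) auto
  show ?thesis
    using assms by (subst sum_over_permutations_insert) (auto simp: bc add.assoc)
qed

text \<open>The signed sum over the six column permutations is the Leibniz expansion of a
  determinant. Cell 1 belongs to the row as well, so its image is unconstrained; this is the row of
  ones.\<close>

lemma young_symmetrizer_hook2:
  assumes "n \<ge> 3"
  shows "young_symmetrizer n [n - 2, 1, 1] = pos_minor n (n - 1) n 1 (n - 1) n"
proof -
  have n: "n - 2 + 2 = n" using assms by simp
  have Y: "insert 1 {n - 2 + 1..n} = {1, n - 1, n}" using assms by auto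
  have "replicate 2 (1::nat) = [1, 1]" by (simp add: numeral_2_eq_2)
  hence ys: "young_symmetrizer n [n - 2, 1, 1] = ga_mult n (row_sum {1..n - 2}) (col_sum {1, n - 1, n})"
    using young_symmetrizer_hook[of "n - 2" 2] assms unfolding n Y by simp
  have rest: "{1..n} - {1..n - 2} = {n - 1, n}" using assms by auto
  have d: "1 \<noteq> n - 1" "1 \<noteq> n" "n - 1 \<noteq> n" using assms by auto
  have neq: "n - 1 \<noteq> 1" "n \<noteq> 1" "n \<noteq> n - 1" using d by auto
  have XY: "{1..n - 2} \<subseteq> {1..n}" "{1, n - 1, n} \<subseteq> {1..n}" using assms by auto
  show ?thesis
    unfolding ys
  proof (rule group_algebra_eqI[of _ n])
    fix \<rho> assume \<rho>: "\<rho> \<in> Sym n"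
    have inj: "\<rho> (n - 1) \<noteq> \<rho> n" using \<rho> d by (simp add: inj_Sym)
    have sgn: "sign (transpose x y \<circ> transpose z w) = sign (transpose x y) * sign (transpose z w)" for x y z w :: nat
      by (intro sign_compose permutation_swap_id)
    show "ga_mult n (row_sum {1..n - 2}) (col_sum {1, n - 1, n}) \<rho> = pos_minor n (n - 1) n 1 (n - 1) n \<rho>"
      unfolding row_col_apply[OF XY \<rho>] rest sum_permutes_triple[OF d] sgn sign_swap_id
      using d neq \<rho> by (simp add: pos_minor_def transpose_def of_bool_def)
  qed simp_all
qed

lemma conj_sum_annihilates:
  assumes "\<And>x. x \<in> group_algebra n \<Longrightarrow> ga_mult n c (ga_mult n x c') = 0"
  shows "ga_mult n (conj_sum n (ga_mult n c d)) c' = 0"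
  using assms[of "ga_mult n d (ga_of (inv _))"]
  by (simp add: conj_sum_def ga_mult_linear ga_mult_assoc)

text \<open>The column of the second hook has three cells, while a single point, \<open>n\<close>,
  lies off the first row of the other hook. Hence every permutation sends two cells of that row into
  the column, and \<open>row_col_vanish\<close> applies.\<close>

lemma hook_symmetrizers_orthogonal:
  assumes "n \<ge> 3" "x \<in> group_algebra n"
  shows "ga_mult n (young_symmetrizer n [n - 1, 1])
    (ga_mult n x (young_symmetrizer n [n - 2, 1, 1])) = 0"
proof -
  let ?X = "{1..n - 1}" and ?Y = "{1, n - 1, n}"
  have n: "n - 1 + 1 = n" "n - 2 + 2 = n" using assms by auto
  have Y: "insert 1 {n - 2 + 1..n} = ?Y" using assms by auto
  have ys1: "young_symmetrizer n [n - 1, 1] = ga_mult n (row_sum ?X) (col_sum (insert 1 {n - 1 + 1..n}))"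
    using young_symmetrizer_hook[of "n - 1" 1] assms unfolding n by (simp add: One_nat_def)
  have "replicate 2 (1::nat) = [1, 1]" by (simp add: numeral_2_eq_2)
  hence ys2: "young_symmetrizer n [n - 2, 1, 1] = ga_mult n (row_sum {1..n - 2}) (col_sum ?Y)"
    using young_symmetrizer_hook[of "n - 2" 2] assms unfolding n Y by simp
  have van: "ga_mult n (row_sum ?X) (ga_mult n (ga_of \<sigma>) (col_sum ?Y)) = 0" if \<sigma>: "\<sigma> \<in> Sym n" for \<sigma>
  proof -
    have "card ?Y = 3" using assms by simp
    hence "card (?Y - {\<sigma> n}) \<ge> 2" by (simp add: card_Diff_singleton_if)
    then obtain y1 y2 where y: "y1 \<in> ?Y - {\<sigma> n}" "y2 \<in> ?Y - {\<sigma> n}" "y1 \<noteq> y2"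
      by (metis card_le_Suc0_iff_eq One_nat_def Suc_1 card.infinite not_less_eq_eq zero_le)
    have range: "y1 \<in> {1..n}" "y2 \<in> {1..n}" using y assms by auto
    have X: "inv \<sigma> y \<in> ?X" if "y \<in> {1..n}" "y \<noteq> \<sigma> n" for y
    proof -
      have "inv \<sigma> y \<in> {1..n}" using \<sigma> that by (simp del: atLeastAtMost_iff)
      moreover have "inv \<sigma> y \<noteq> n" using \<sigma> that by auto
      ultimately show ?thesis by auto
    qed
    show ?thesis
    proof (rule row_col_vanish[OF _ _ \<sigma>])
      show "inv \<sigma> y1 \<in> ?X" "inv \<sigma> y2 \<in> ?X" using X y range by auto
      show "inv \<sigma> y1 \<noteq> inv \<sigma> y2" using \<sigma> y by (simp add: inj_Sym[of "inv \<sigma>" n])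
      show "\<sigma> (inv \<sigma> y1) \<in> ?Y" "\<sigma> (inv \<sigma> y2) \<in> ?Y" using \<sigma> y by auto
    qed (use assms in auto)
  qed
  have van': "ga_mult n (row_sum ?X) (ga_mult n y (col_sum ?Y)) = 0" if "y \<in> group_algebra n" for y
    by (subst ga_expand[OF that]) (simp add: ga_mult_linear van)
  show ?thesis
    using van'[of "ga_mult n (col_sum (insert 1 {n - 1 + 1..n})) (ga_mult n x (row_sum {1..n - 2}))"]
    by (simp add: ys1 ys2 ga_mult_assoc)
qed

text \<open>Orthogonality of the symmetrizers is available in one order and gives
  \<open>C1 c2 = 0\<close>. The other annihilation goes through the idempotents:
  \<open>C1 C2 = 0\<close>, these commute, and \<open>c1 = C1 c1\<close>.\<close>

lemma hook_idempotents:
  assumes "n \<ge> 3"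
  defines "C1 \<equiv> irrep_idempotent n [n - 1, 1]" and "C2 \<equiv> irrep_idempotent n [n - 2, 1, 1]"
  defines "c1 \<equiv> young_symmetrizer n [n - 1, 1]" and "c2 \<equiv> young_symmetrizer n [n - 2, 1, 1]"
  shows "central_idempotent n C1" "central_idempotent n C2"
    "ga_mult n C1 c1 = c1" "ga_mult n C2 c2 = c2" "ga_mult n C1 c2 = 0" "ga_mult n C2 c1 = 0"
proof -
  have n: "n - 1 + 1 = n" "n - 2 + 2 = n" using assms by auto
  have m: "1 \<le> n - 1" "1 \<le> n - 2" using assms(1) by auto
  have r: "replicate 1 (1::nat) = [1]" "replicate 2 (1::nat) = [1, 1]"
    by (simp_all add: numeral_2_eq_2 One_nat_def)
  obtain s where C1: "C1 = ga_scale s (conj_sum n (ga_mult n c1 (ga_adj n c1)))"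
    and 1: "central_idempotent n C1" "ga_mult n C1 c1 = c1"
    using irrep_idempotent_hook[OF m(1), of 1, unfolded n r, folded c1_def, folded C1_def] by blast
  obtain t where C2: "C2 = ga_scale t (conj_sum n (ga_mult n c2 (ga_adj n c2)))"
    and 2: "central_idempotent n C2" "ga_mult n C2 c2 = c2"
    using irrep_idempotent_hook[OF m(2), of 2, unfolded n r, folded c2_def, folded C2_def] by blast
  show "central_idempotent n C1" "central_idempotent n C2"
    "ga_mult n C1 c1 = c1" "ga_mult n C2 c2 = c2" by fact+
  show 12: "ga_mult n C1 c2 = 0"
    unfolding C1 ga_mult_linear using hook_symmetrizers_orthogonal[OF assms(1)]
    by (subst conj_sum_annihilates) (simp_all add: c1_def c2_def)
  have "ga_mult n C1 (conj_sum n (ga_mult n c2 (ga_adj n c2))) = 0"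
    using central_idempotentD(3)[OF 1(1)]
    by (intro mult_conj_sum_eq_0) (simp_all add: 12 flip: ga_mult_assoc)
  hence "ga_mult n C1 C2 = 0" by (simp add: C2 ga_mult_linear)
  hence "ga_mult n C2 C1 = 0" using central_idempotentD(3)[OF 2(1) central_idempotentD(1)[OF 1(1)]] by simp
  thus "ga_mult n C2 c1 = 0" by (metis 1(2) ga_mult_assoc ga_mult_zero(1))
qed

text \<open>For distinct \<open>k\<close> and \<open>l\<close> the difference is a translate of the
  symmetrizer: the left factor moves the position \<open>n\<close> to \<open>i\<close>, the right
  one moves the values \<open>n\<close> and 1 to \<open>k\<close> and \<open>l\<close>.\<close>

lemma eigen_pos_ind:
  assumes "n \<ge> 3" "i \<in> {1..n}" "k \<in> {1..n}" "l \<in> {1..n}"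
  shows "ga_mult n (irrep_idempotent n [n - 1, 1]) (pos_ind n i k - pos_ind n i l) = pos_ind n i k - pos_ind n i l"
    "ga_mult n (irrep_idempotent n [n - 2, 1, 1]) (pos_ind n i k - pos_ind n i l) = 0"
proof -
  let ?c = "young_symmetrizer n [n - 1, 1]"
  have "(\<exists>\<sigma>\<in>Sym n. \<exists>\<tau>\<in>Sym n.
    pos_ind n i k - pos_ind n i l = ga_mult n (ga_of \<sigma>) (ga_mult n ?c (ga_of \<tau>))) \<or> k = l"
  proof (rule disjCI)
    assume "k \<noteq> l"
    hence "inj_on (\<lambda>x. if x = 1 then l else k) {1, n}" using assms(1) by (auto simp: inj_on_def)
    then obtain \<tau> where \<tau>: "\<tau> permutes {1..n}" "\<And>x. x \<in> {1, n} \<Longrightarrow> \<tau> x = (if x = 1 then l else k)"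
      using assms permutes_extension[of "{1..n}" "{1, n}" "\<lambda>x. if x = 1 then l else k"] by auto
    have \<tau>S: "\<tau> \<in> Sym n" and \<sigma>S: "transpose i n \<in> Sym n"
      using \<tau> assms by (auto simp: Sym_def intro!: permutes_swap_id)
    have \<tau>v: "\<tau> 1 = l" "\<tau> n = k" using \<tau>(2)[of 1] \<tau>(2)[of n] assms(1) by auto
    have *: "inv \<tau> x = y \<longleftrightarrow> x = \<tau> y" for x y using \<tau>S by (metis inv_o_Sym(3,4))
    have "pos_ind n i k - pos_ind n i l = ga_mult n (ga_of (transpose i n)) (ga_mult n ?c (ga_of \<tau>))"
      using assms(1)
      by (intro group_algebra_eqI[of _ n])
        (simp_all add: translate_apply[OF \<sigma>S \<tau>S] young_symmetrizer_hook1 pos_ind_apply \<sigma>S \<tau>S * \<tau>v)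
    thus "\<exists>\<sigma>\<in>Sym n. \<exists>\<tau>\<in>Sym n.
      pos_ind n i k - pos_ind n i l = ga_mult n (ga_of \<sigma>) (ga_mult n ?c (ga_of \<tau>))"
      using \<tau>S \<sigma>S by blast
  qed
  thus "ga_mult n (irrep_idempotent n [n - 1, 1]) (pos_ind n i k - pos_ind n i l) = pos_ind n i k - pos_ind n i l"
    "ga_mult n (irrep_idempotent n [n - 2, 1, 1]) (pos_ind n i k - pos_ind n i l) = 0"
    using translate_eigen[of n "irrep_idempotent n [n - 1, 1]" ?c 1]
      translate_eigen[of n "irrep_idempotent n [n - 2, 1, 1]" ?c 0] hook_idempotents[OF assms(1)]
    by auto
qed

text \<open>Again a translate: \<open>\<sigma>\<close> takes the positions \<open>i\<close>,
  \<open>j\<close> to \<open>n - 1\<close>, \<open>n\<close>, and \<open>\<tau>\<close> takes the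
  values 1, \<open>n - 1\<close>, \<open>n\<close> to \<open>p\<close>, \<open>q\<close>,
  \<open>r\<close>.\<close>

lemma eigen_pos_minor:
  assumes "n \<ge> 3" "i \<in> {1..n}" "j \<in> {1..n}" "i \<noteq> j" "p \<in> {1..n}" "q \<in> {1..n}" "r \<in> {1..n}"
  shows "ga_mult n (irrep_idempotent n [n - 1, 1]) (pos_minor n i j p q r) = 0"
    "ga_mult n (irrep_idempotent n [n - 2, 1, 1]) (pos_minor n i j p q r) = pos_minor n i j p q r"
proof -
  let ?c = "young_symmetrizer n [n - 2, 1, 1]"
  have "(\<exists>\<sigma>\<in>Sym n. \<exists>\<tau>\<in>Sym n.
    pos_minor n i j p q r = ga_mult n (ga_of \<sigma>) (ga_mult n ?c (ga_of \<tau>))) \<or> pos_minor n i j p q r = 0"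
  proof (cases "p \<noteq> q \<and> p \<noteq> r \<and> q \<noteq> r")
    case True
    let ?f = "\<lambda>x. if x = 1 then p else if x = n - 1 then q else r"
    let ?g = "\<lambda>x. if x = i then n - 1 else n"
    have "inj_on ?f {1, n - 1, n}" using True assms(1) by (auto simp: inj_on_def)
    moreover have "?f ` {1, n - 1, n} \<subseteq> {1..n}" "{1, n - 1, n} \<subseteq> {1..n}" using assms by auto
    ultimately obtain \<tau> where \<tau>: "\<tau> permutes {1..n}" "\<And>x. x \<in> {1, n - 1, n} \<Longrightarrow> \<tau> x = ?f x"
      using permutes_extension[of "{1..n}" "{1, n - 1, n}" ?f] by auto
    have "inj_on ?g {i, j}" using assms(1,4) by (auto simp: inj_on_def)
    moreover have "?g ` {i, j} \<subseteq> {1..n}" "{i, j} \<subseteq> {1..n}" using assms by auto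
    ultimately obtain \<sigma> where \<sigma>: "\<sigma> permutes {1..n}" "\<And>x. x \<in> {i, j} \<Longrightarrow> \<sigma> x = ?g x"
      using permutes_extension[of "{1..n}" "{i, j}" ?g] by auto
    have \<tau>S: "\<tau> \<in> Sym n" and \<sigma>S: "\<sigma> \<in> Sym n" using \<tau> \<sigma> by (auto simp: Sym_def)
    have \<tau>v: "\<tau> 1 = p" "\<tau> (n - 1) = q" "\<tau> n = r"
      using \<tau>(2)[of 1] \<tau>(2)[of "n - 1"] \<tau>(2)[of n] assms(1) by (auto split: if_splits)
    have "\<sigma> i = n - 1" "\<sigma> j = n" using \<sigma>(2)[of i] \<sigma>(2)[of j] assms(4) by auto
    hence \<sigma>v: "inv \<sigma> (n - 1) = i" "inv \<sigma> n = j" using \<sigma>S by (metis inv_o_Sym(4))+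
    have *: "inv \<tau> x = y \<longleftrightarrow> x = \<tau> y" for x y using \<tau>S by (metis inv_o_Sym(3,4))
    have "pos_minor n i j p q r = ga_mult n (ga_of \<sigma>) (ga_mult n ?c (ga_of \<tau>))"
      using assms(1)
      by (intro group_algebra_eqI[of _ n])
        (simp_all add: translate_apply[OF \<sigma>S \<tau>S] young_symmetrizer_hook2 pos_minor_apply \<sigma>S \<tau>S * \<tau>v \<sigma>v)
    thus ?thesis using \<tau>S \<sigma>S by blast
  next
    case False
    \<comment> \<open>A determinant with two equal columns.\<close>
    hence "pos_minor n i j p q r = 0" by (auto simp: pos_minor_def fun_eq_iff)
    thus ?thesis ..
  qed
  thus "ga_mult n (irrep_idempotent n [n - 1, 1]) (pos_minor n i j p q r) = 0"
    "ga_mult n (irrep_idempotent n [n - 2, 1, 1]) (pos_minor n i j p q r) = pos_minor n i j p q r"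
    using translate_eigen[of n "irrep_idempotent n [n - 1, 1]" ?c 0]
      translate_eigen[of n "irrep_idempotent n [n - 2, 1, 1]" ?c 1] hook_idempotents[OF assms(1)]
    by auto
qed

subsection \<open>The isotypic decomposition of the sign vectors\<close>

definition cmp :: "nat \<Rightarrow> nat \<Rightarrow> complex" where
  "cmp p q = (if p < q then 1 else if q < p then -1 else 0)"

lemma cmp_skew: "cmp q p = - cmp p q"
  by (simp add: cmp_def)

lemma cmp_refl [simp]: "cmp p p = 0"
  by (simp add: cmp_def)

lemma cnj_cmp [simp]: "cnj (cmp p q) = cmp p q"
  by (simp add: cmp_def)

text \<open>There are \<open>n - p\<close> larger indices and \<open>p - 1\<close> smaller
  ones.\<close>

lemma sum_cmp:
  assumes "p \<in> {1..n}"
  shows "(\<Sum>q\<in>{1..n}. cmp p q) = of_nat n + 1 - 2 * of_nat p"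
proof -
  have "{1..n} = {1..<p} \<union> ({p} \<union> {p<..n})" using assms by auto
  moreover have "(\<Sum>q\<in>{1..<p} \<union> ({p} \<union> {p<..n}). cmp p q) =
      (\<Sum>q\<in>{1..<p}. cmp p q) + (\<Sum>q\<in>{p} \<union> {p<..n}. cmp p q)"
    by (rule sum.union_disjoint) auto
  ultimately have "(\<Sum>q\<in>{1..n}. cmp p q) = (\<Sum>q\<in>{1..<p}. cmp p q) + (\<Sum>q\<in>{p} \<union> {p<..n}. cmp p q)"
    by simp
  also have "(\<Sum>q\<in>{1..<p}. cmp p q) = (\<Sum>q\<in>{1..<p}. -1)"
    by (intro sum.cong) (auto simp: cmp_def)
  also have "(\<Sum>q\<in>{p} \<union> {p<..n}. cmp p q) = (\<Sum>q\<in>{p<..n}. cmp p q)"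
    by simp
  also have "\<dots> = (\<Sum>q\<in>{p<..n}. 1)"
    by (intro sum.cong) (auto simp: cmp_def)
  finally show ?thesis using assms by (simp add: of_nat_diff)
qed

lemma sum_linear_nat: "(\<Sum>k\<in>{1..n}. of_nat n + 1 - 2 * of_nat k :: complex) = 0"
proof -
  \<comment> \<open>The constant in the summand is decoupled from the upper limit so that induction
    on the limit goes through.\<close>
  have "(\<Sum>k\<in>{1..n}. of_nat m - 2 * of_nat k :: complex) = of_nat n * (of_nat m - of_nat n - 1)" for m
    by (induction n) (simp_all add: algebra_simps)
  from this[of "n + 1"] show ?thesis by simp
qed

text \<open>The \<open>u i j\<close> of the overview; \<open>rank_vec\<close> and
  \<open>hook_vec\<close> are its \<open>h i\<close> and \<open>g i j\<close>. Unlike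
  \<open>eps\<close>, it vanishes for equal indices, so it is skew on all pairs.\<close>

definition sgn_vec :: "nat \<Rightarrow> nat \<Rightarrow> nat \<Rightarrow> ga" where
  "sgn_vec n i j = (\<lambda>\<sigma>. if \<sigma> \<in> Sym n then cmp (\<sigma> i) (\<sigma> j) else 0)"

definition rank_vec :: "nat \<Rightarrow> nat \<Rightarrow> ga" where
  "rank_vec n i = (\<Sum>k\<in>{1..n}. sgn_vec n i k)"

definition hook_vec :: "nat \<Rightarrow> nat \<Rightarrow> nat \<Rightarrow> ga" where
  "hook_vec n i j = ga_scale (of_nat n) (sgn_vec n i j) - (rank_vec n i - rank_vec n j)"

lemma sgn_vec_apply: "\<sigma> \<in> Sym n \<Longrightarrow> sgn_vec n i j \<sigma> = cmp (\<sigma> i) (\<sigma> j)"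
  by (simp add: sgn_vec_def)

lemma sgn_vec_closed [simp]: "sgn_vec n i j \<in> group_algebra n"
  by (simp add: sgn_vec_def group_algebra_def)

lemma rank_vec_closed [simp]: "rank_vec n i \<in> group_algebra n"
  by (simp add: rank_vec_def)

lemma hook_vec_closed [simp]: "hook_vec n i j \<in> group_algebra n"
  by (simp add: hook_vec_def)

lemma sgn_vec_skew: "sgn_vec n j i = - sgn_vec n i j"
  by (auto simp: sgn_vec_def fun_eq_iff cmp_skew[of "_ j"])

lemma sgn_vec_refl [simp]: "sgn_vec n i i = 0"
  by (simp add: sgn_vec_def fun_eq_iff)

lemma sum_Sym_image: "\<sigma> \<in> Sym n \<Longrightarrow> (\<Sum>k\<in>{1..n}. f (\<sigma> k)) = (\<Sum>k\<in>{1..n}. f k)"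
  unfolding Sym_def mem_Collect_eq by (rule sum.reindex_bij_betw[OF permutes_imp_bij])

lemma rank_vec_apply:
  assumes "\<sigma> \<in> Sym n" "i \<in> {1..n}"
  shows "rank_vec n i \<sigma> = of_nat n + 1 - 2 * of_nat (\<sigma> i)"
proof -
  have "rank_vec n i \<sigma> = (\<Sum>k\<in>{1..n}. cmp (\<sigma> i) (\<sigma> k))"
    using assms by (simp add: rank_vec_def sum_fun_apply sgn_vec_apply)
  also have "\<dots> = (\<Sum>k\<in>{1..n}. cmp (\<sigma> i) k)" by (rule sum_Sym_image[OF assms(1)])
  also have "\<dots> = of_nat n + 1 - 2 * of_nat (\<sigma> i)"
    using assms by (intro sum_cmp) (simp del: atLeastAtMost_iff)
  finally show ?thesis .
qed

lemma sum_of_bool_mult: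
  fixes f :: "nat \<Rightarrow> complex"
  assumes "finite S" "a \<in> S"
  shows "(\<Sum>p\<in>S. f p * of_bool (a = p)) = f a"
  using assms by (simp add: of_bool_def if_distrib[of "(*) _"] cong: if_cong)

lemma sum_of_bool_shift:
  fixes f :: "nat \<Rightarrow> complex"
  assumes "finite S" "a \<in> S"
  shows "(\<Sum>p\<in>S. f p * (of_bool (a = p) - d)) = f a - sum f S * d"
  by (simp only: right_diff_distrib sum_subtractf sum_of_bool_mult[OF assms] sum_distrib_right)

text \<open>The coefficients add up to 0, so a fixed \<open>pos_ind n i 1\<close> may be subtracted
  from every term; what remains are differences covered by \<open>eigen_pos_ind\<close>.\<close>

lemma rank_vec_expand:
  assumes "n \<ge> 1" "i \<in> {1..n}"
  shows "rank_vec n i = (\<Sum>k\<in>{1..n}. ga_scale (of_nat n + 1 - 2 * of_nat k) (pos_ind n i k - pos_ind n i 1))"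
proof (rule group_algebra_eqI[of _ n])
  fix \<sigma> assume \<sigma>: "\<sigma> \<in> Sym n"
  have "\<sigma> i \<in> {1..n}" using \<sigma> assms by (simp del: atLeastAtMost_iff)
  hence "(\<Sum>k\<in>{1..n}. (of_nat n + 1 - 2 * of_nat k) * (of_bool (\<sigma> i = k) - of_bool (\<sigma> i = 1))) =
      of_nat n + 1 - 2 * (of_nat (\<sigma> i) :: complex)"
    using sum_of_bool_shift[of "{1..n}" "\<sigma> i" "\<lambda>k. of_nat n + 1 - 2 * of_nat k" "of_bool (\<sigma> i = 1)"]
    unfolding sum_linear_nat by simp
  thus "rank_vec n i \<sigma> = (\<Sum>k\<in>{1..n}. ga_scale (of_nat n + 1 - 2 * of_nat k) (pos_ind n i k - pos_ind n i 1)) \<sigma>"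
    using \<sigma> assms(2) by (simp add: rank_vec_apply sum_fun_apply pos_ind_apply del: atLeastAtMost_iff)
qed simp_all

text \<open>\<open>S p q\<close> is the value of \<open>hook_vec\<close> at a permutation with
  \<open>\<sigma> i = p\<close> and \<open>\<sigma> j = q\<close>. As \<open>S\<close> is skew, the
  first two terms of the minor give \<open>S\<close> twice. The four terms involving the fixed third
  column 1 disappear because all row and column sums of \<open>S\<close> are 0.\<close>

lemma hook_vec_expand:
  assumes "n \<ge> 1" "i \<in> {1..n}" "j \<in> {1..n}"
  defines "S \<equiv> \<lambda>p q. of_nat n * cmp p q + 2 * of_nat p - 2 * of_nat q"
  shows "ga_scale 2 (hook_vec n i j) =
    (\<Sum>p\<in>{1..n}. \<Sum>q\<in>{1..n}. ga_scale (S p q) (pos_minor n i j p q 1))"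
proof (rule group_algebra_eqI[of _ n])
  fix \<sigma> assume \<sigma>: "\<sigma> \<in> Sym n"
  define a b where "a = \<sigma> i" and "b = \<sigma> j"
  have ab: "a \<in> {1..n}" "b \<in> {1..n}" using \<sigma> assms(2,3) by (simp_all add: a_def b_def del: atLeastAtMost_iff)
  have skew: "S q p = - S p q" for p q by (simp add: S_def cmp_skew[of q p])
  have row: "(\<Sum>q\<in>{1..n}. S p q) = 0" if "p \<in> {1..n}" for p
  proof -
    have "(\<Sum>q\<in>{1..n}. S p q) = of_nat n * (\<Sum>q\<in>{1..n}. cmp p q) +
        ((\<Sum>q\<in>{1..n}. of_nat n + 1 - 2 * of_nat q) - of_nat n * (of_nat n + 1 - 2 * of_nat p))"
      by (simp add: S_def sum.distrib sum_subtractf sum_distrib_left algebra_simps)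
    thus ?thesis by (simp add: sum_cmp that sum_linear_nat del: atLeastAtMost_iff)
  qed
  have col: "(\<Sum>p\<in>{1..n}. S p q) = 0" if "q \<in> {1..n}" for q
  proof -
    have "(\<Sum>p\<in>{1..n}. S p q) = (\<Sum>p\<in>{1..n}. - S q p)" by (intro sum.cong refl skew)
    thus ?thesis by (simp only: sum_negf row[OF that] minus_zero)
  qed
  let ?x = "\<lambda>p. of_bool (a = p) :: complex" and ?y = "\<lambda>p. of_bool (b = p) :: complex"
  have xy: "(\<Sum>p\<in>{1..n}. \<Sum>q\<in>{1..n}. S p q * (?x p * ?y q)) = S a b"
  proof -
    have "(\<Sum>p\<in>{1..n}. \<Sum>q\<in>{1..n}. S p q * (?x p * ?y q)) =
        (\<Sum>p\<in>{1..n}. (\<Sum>q\<in>{1..n}. S p q * ?y q) * ?x p)"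
      by (simp only: sum_distrib_right) (simp only: mult_ac)
    thus ?thesis using ab by (simp only: sum_of_bool_mult finite_atLeastAtMost)
  qed
  have yx: "(\<Sum>p\<in>{1..n}. \<Sum>q\<in>{1..n}. S p q * (?x q * ?y p)) = - S a b"
  proof -
    have "(\<Sum>p\<in>{1..n}. \<Sum>q\<in>{1..n}. S p q * (?x q * ?y p)) =
        (\<Sum>q\<in>{1..n}. \<Sum>p\<in>{1..n}. S p q * (?x q * ?y p))" by (rule sum.swap)
    also have "\<dots> = (\<Sum>q\<in>{1..n}. \<Sum>p\<in>{1..n}. - (S q p * (?x q * ?y p)))"
      by (intro sum.cong refl) (subst skew, simp only: mult_minus_left)
    also have "\<dots> = - S a b" by (simp only: sum_negf xy)
    finally show ?thesis .
  qed
  have t4: "(\<Sum>p\<in>{1..n}. \<Sum>q\<in>{1..n}. S p q * (f p * c)) = 0" for f c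
    by (simp only: sum_distrib_right[symmetric] row mult_zero_left sum.neutral_const cong: sum.cong)
  have t3: "(\<Sum>p\<in>{1..n}. \<Sum>q\<in>{1..n}. S p q * (f q * c)) = 0" for f c
  proof -
    have "(\<Sum>p\<in>{1..n}. \<Sum>q\<in>{1..n}. S p q * (f q * c)) =
      (\<Sum>q\<in>{1..n}. \<Sum>p\<in>{1..n}. S p q * (f q * c))" by (rule sum.swap)
    also have "\<dots> = 0"
      by (simp only: sum_distrib_right[symmetric] col mult_zero_left sum.neutral_const cong: sum.cong)
    finally show ?thesis .
  qed
  have "(\<Sum>p\<in>{1..n}. \<Sum>q\<in>{1..n}. ga_scale (S p q) (pos_minor n i j p q 1)) \<sigma> =
     (\<Sum>p\<in>{1..n}. \<Sum>q\<in>{1..n}. S p q * (?x p * ?y q)) - (\<Sum>p\<in>{1..n}. \<Sum>q\<in>{1..n}. S p q * (?x q * ?y p)) +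
     (\<Sum>p\<in>{1..n}. \<Sum>q\<in>{1..n}. S p q * (?x q * ?y 1)) - (\<Sum>p\<in>{1..n}. \<Sum>q\<in>{1..n}. S p q * (?y q * ?x 1)) +
     (\<Sum>p\<in>{1..n}. \<Sum>q\<in>{1..n}. S p q * (?y p * ?x 1)) - (\<Sum>p\<in>{1..n}. \<Sum>q\<in>{1..n}. S p q * (?x p * ?y 1))"
    unfolding sum_fun_apply ga_apply pos_minor_apply[OF \<sigma>] a_def[symmetric] b_def[symmetric]
      sum.distrib[symmetric] sum_subtractf[symmetric]
    by (intro sum.cong refl) (simp only: ring_distribs mult_ac)
  also have "\<dots> = 2 * S a b" unfolding xy yx t3 t4 by simp
  also have "\<dots> = ga_scale 2 (hook_vec n i j) \<sigma>"
    using \<sigma> assms(2,3) by (simp add: hook_vec_def rank_vec_apply sgn_vec_apply S_def a_def b_def algebra_simps)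
  finally show "ga_scale 2 (hook_vec n i j) \<sigma> =
    (\<Sum>p\<in>{1..n}. \<Sum>q\<in>{1..n}. ga_scale (S p q) (pos_minor n i j p q 1)) \<sigma>" by simp
qed simp_all

lemma eigen_rank_vec:
  assumes "n \<ge> 3" "i \<in> {1..n}"
  shows "ga_mult n (irrep_idempotent n [n - 1, 1]) (rank_vec n i) = rank_vec n i"
    "ga_mult n (irrep_idempotent n [n - 2, 1, 1]) (rank_vec n i) = 0"
proof -
  have n: "n \<ge> 1" "1 \<in> {1..n}" using assms(1) by auto
  show "ga_mult n (irrep_idempotent n [n - 1, 1]) (rank_vec n i) = rank_vec n i"
    "ga_mult n (irrep_idempotent n [n - 2, 1, 1]) (rank_vec n i) = 0"
    unfolding rank_vec_expand[OF n(1) assms(2)] ga_mult_sum_right ga_mult_scale_right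
    using eigen_pos_ind[OF assms _ n(2)] by simp_all
qed

lemma eigen_hook_vec:
  assumes "n \<ge> 3" "i \<in> {1..n}" "j \<in> {1..n}"
  shows "ga_mult n (irrep_idempotent n [n - 1, 1]) (hook_vec n i j) = 0"
    "ga_mult n (irrep_idempotent n [n - 2, 1, 1]) (hook_vec n i j) = hook_vec n i j"
proof -
  have n: "n \<ge> 1" "1 \<in> {1..n}" using assms(1) by auto
  have half: "hook_vec n i j = ga_scale (1/2) (ga_scale 2 (hook_vec n i j))" by simp
  have eig: "ga_mult n (irrep_idempotent n [n - 1, 1]) (ga_scale 2 (hook_vec n i j)) = 0"
    "ga_mult n (irrep_idempotent n [n - 2, 1, 1]) (ga_scale 2 (hook_vec n i j)) = ga_scale 2 (hook_vec n i j)"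
    if "i \<noteq> j"
    unfolding hook_vec_expand[OF n(1) assms(2,3)] ga_mult_sum_right ga_mult_scale_right
    using eigen_pos_minor[OF assms that _ _ n(2)] by simp_all
  have "hook_vec n i j = 0" if "i = j" using that by (simp add: hook_vec_def)
  thus "ga_mult n (irrep_idempotent n [n - 1, 1]) (hook_vec n i j) = 0"
    "ga_mult n (irrep_idempotent n [n - 2, 1, 1]) (hook_vec n i j) = hook_vec n i j"
    using eig by (cases "i = j"; subst half; simp add: ga_mult_scale_right)+
qed

lemma ga_of_mult_sgn_vec:
  assumes "\<pi> \<in> Sym n"
  shows "ga_mult n (ga_of \<pi>) (sgn_vec n i j) = sgn_vec n (inv \<pi> i) (inv \<pi> j)"
  using assms by (intro group_algebra_eqI[of _ n]) (simp_all add: ga_of_mult_apply sgn_vec_apply)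

lemma e_eq_sgn_vec:
  assumes "i \<noteq> j"
  shows "e n i j = ga_scale (of_real (1 / sqrt (fact n))) (sgn_vec n i j)"
proof (rule group_algebra_eqI[of _ n])
  fix \<sigma> assume \<sigma>: "\<sigma> \<in> Sym n"
  have "eps i j \<sigma> = cmp (\<sigma> i) (\<sigma> j)"
    using inj_Sym[OF \<sigma>, of i j] assms by (auto simp: eps_def cmp_def)
  thus "e n i j \<sigma> = ga_scale (of_real (1 / sqrt (fact n))) (sgn_vec n i j) \<sigma>"
    using \<sigma> by (simp add: e_def sum_fun_apply sgn_vec_apply if_distrib[of "(*) _"] cong: if_cong)
qed (simp_all add: e_def)

subsection \<open>The orthonormal system\<close>

text \<open>This is \<open>e' i j\<close>, extended skew-symmetrically to all pairs of indices.\<close>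

definition onb :: "nat \<Rightarrow> nat \<Rightarrow> nat \<Rightarrow> ga" where
  "onb n i j = (if i \<in> {1..n} \<and> j \<in> {1..n} then
     ga_scale (of_real (sqrt 3 / (sqrt (fact n) * real n)))
       (ga_scale (of_real (1 / sqrt (real n + 1))) (rank_vec n i - rank_vec n j) + hook_vec n i j)
     else 0)"

text \<open>Dividing the decomposition of \<open>sgn_vec\<close> by n accounts for the n in the
  denominator of \<open>onb\<close>; the factor \<open>sqrt (real n + 1)\<close> in \<open>A\<close>
  cancels on the hook part and stays as a divisor on the rank part.\<close>

lemma e'_eq_onb:
  assumes "n \<ge> 3" "i \<in> {1..n}" "j \<in> {1..n}" "i \<noteq> j"
  shows "e' n i j = onb n i j"
proof -
  have n: "sqrt (real n + 1) \<noteq> 0" "real n \<noteq> 0" using assms(1) by auto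
  have U: "sgn_vec n i j = ga_scale (1 / of_nat n) (rank_vec n i - rank_vec n j + hook_vec n i j)"
    using n by (simp add: hook_vec_def)
  have C1: "ga_mult n (irrep_idempotent n [n - 1, 1]) (sgn_vec n i j) =
      ga_scale (1 / of_nat n) (rank_vec n i - rank_vec n j)"
    unfolding U ga_mult_linear by (simp add: eigen_rank_vec eigen_hook_vec assms del: atLeastAtMost_iff)
  have C2: "ga_mult n (irrep_idempotent n [n - 2, 1, 1]) (sgn_vec n i j) =
      ga_scale (1 / of_nat n) (hook_vec n i j)"
    unfolding U ga_mult_linear by (simp add: eigen_rank_vec eigen_hook_vec assms del: atLeastAtMost_iff)
  have "e' n i j = ga_scale (of_real (1 / sqrt (fact n))) (ga_scale (of_real (sqrt 3 / sqrt (real n + 1)))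
      (ga_scale (1 / of_nat n) (rank_vec n i - rank_vec n j) +
       ga_scale (of_real (sqrt (real n + 1))) (ga_scale (1 / of_nat n) (hook_vec n i j))))"
    unfolding e'_def e_eq_sgn_vec[OF assms(4)] A_def ga_mult_linear C1 C2 by (rule refl)
  also have "\<dots> = onb n i j"
    using assms n by (simp add: onb_def ga.scale_right_distrib)
  finally show ?thesis .
qed

section \<open>Inner products of sign vectors and rank vectors\<close>

lemma ga_inner_linear:
  "ga_inner n x (y + z) = ga_inner n x y + ga_inner n x z"
  "ga_inner n x (y - z) = ga_inner n x y - ga_inner n x z"
  "ga_inner n x (- y) = - ga_inner n x y"
  "ga_inner n x (ga_scale c y) = c * ga_inner n x y"
  "ga_inner n x (sum f S) = (\<Sum>a\<in>S. ga_inner n x (f a))"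
  "ga_inner n x 0 = 0"
  "ga_inner n (y + z) x = ga_inner n y x + ga_inner n z x"
  "ga_inner n (y - z) x = ga_inner n y x - ga_inner n z x"
  "ga_inner n (- y) x = - ga_inner n y x"
  "ga_inner n (ga_scale c y) x = cnj c * ga_inner n y x"
  "ga_inner n (sum f S) x = (\<Sum>a\<in>S. ga_inner n (f a) x)"
  "ga_inner n 0 x = 0"
  by (simp_all add: ga_inner_def sum_fun_apply sum_distrib_left sum_distrib_right sum.distrib
      sum_subtractf sum_negf ring_distribs mult_ac sum.swap[of _ S])

lemma ga_inner_left_mult:
  assumes "\<pi> \<in> Sym n"
  shows "ga_inner n (ga_mult n (ga_of \<pi>) x) (ga_mult n (ga_of \<pi>) y) = ga_inner n x y"
  unfolding ga_inner_def
  using sum_Sym_comp_right[of "inv \<pi>" n "\<lambda>\<sigma>. cnj (x \<sigma>) * y \<sigma>"] assms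
  by (simp add: ga_of_mult_apply)

lemma ga_inner_sgn_vec_perm:
  assumes "\<pi> \<in> Sym n"
  shows "ga_inner n (sgn_vec n (\<pi> i) (\<pi> j)) (sgn_vec n (\<pi> k) (\<pi> l)) =
    ga_inner n (sgn_vec n i j) (sgn_vec n k l)"
  using ga_inner_left_mult[of "inv \<pi>" n "sgn_vec n i j" "sgn_vec n k l"] assms
  by (simp add: ga_of_mult_sgn_vec)

lemma card_Sym: "card (Sym n) = fact n"
  unfolding Sym_def by (rule card_permutations) auto

text \<open>Transpositions show that the value is the same whichever of \<open>i\<close>,
  \<open>j\<close>, \<open>k\<close> is shared. The integrand is -1 if the shared index has the
  middle position and 1 otherwise, so the three values add up to \<open>fact n\<close>.\<close>

lemma gram_shared:
  assumes "i \<in> {1..n}" "j \<in> {1..n}" "k \<in> {1..n}" "i \<noteq> j" "i \<noteq> k" "j \<noteq> k"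
  shows "ga_inner n (sgn_vec n i j) (sgn_vec n i k) = fact n / 3"
proof -
  let ?G = "\<lambda>a b c d. ga_inner n (sgn_vec n a b) (sgn_vec n c d)"
  have 1: "?G j i j k = ?G i j i k"
    using ga_inner_sgn_vec_perm[OF transpose_in_Sym[OF assms(1,2)], of i j i k] assms(4-6) by simp
  have 2: "?G k j k i = ?G i j i k"
    using ga_inner_sgn_vec_perm[OF transpose_in_Sym[OF assms(1,3)], of i j i k] assms(4-6) by simp
  \<comment> \<open>Of the three positions \<open>\<sigma> i, \<sigma> j, \<sigma> k\<close> exactly one lies between the other two.\<close>
  have "?G i j i k + ?G j i j k + ?G k j k i =
      (\<Sum>\<sigma>\<in>Sym n. cmp (\<sigma> i) (\<sigma> j) * cmp (\<sigma> i) (\<sigma> k) + cmp (\<sigma> j) (\<sigma> i) * cmp (\<sigma> j) (\<sigma> k) +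
        cmp (\<sigma> k) (\<sigma> j) * cmp (\<sigma> k) (\<sigma> i))"
    by (simp add: ga_inner_def sgn_vec_apply sum.distrib)
  also have "\<dots> = (\<Sum>\<sigma>\<in>Sym n. 1)"
  proof (intro sum.cong refl)
    fix \<sigma> assume \<sigma>: "\<sigma> \<in> Sym n"
    have "\<sigma> i \<noteq> \<sigma> j" "\<sigma> i \<noteq> \<sigma> k" "\<sigma> j \<noteq> \<sigma> k" using assms(4-6) by (simp_all add: inj_Sym[OF \<sigma>])
    thus "cmp (\<sigma> i) (\<sigma> j) * cmp (\<sigma> i) (\<sigma> k) + cmp (\<sigma> j) (\<sigma> i) * cmp (\<sigma> j) (\<sigma> k) +
        cmp (\<sigma> k) (\<sigma> j) * cmp (\<sigma> k) (\<sigma> i) = 1"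
      by (auto simp: cmp_def)
  qed
  also have "\<dots> = fact n" by (simp add: card_Sym)
  finally have "3 * ?G i j i k = fact n" using 1 2 by simp
  thus ?thesis by (metis nonzero_mult_div_cancel_left zero_neq_numeral)
qed

text \<open>Transposing \<open>i\<close> and \<open>j\<close> preserves the inner product, fixes
  \<open>k\<close> and \<open>l\<close>, and changes the sign of the first vector.\<close>

lemma gram_disjoint:
  assumes "i \<in> {1..n}" "j \<in> {1..n}" "k \<noteq> i" "k \<noteq> j" "l \<noteq> i" "l \<noteq> j"
  shows "ga_inner n (sgn_vec n i j) (sgn_vec n k l) = 0"
proof -
  have "ga_inner n (sgn_vec n j i) (sgn_vec n k l) = ga_inner n (sgn_vec n i j) (sgn_vec n k l)"
    using ga_inner_sgn_vec_perm[OF transpose_in_Sym[OF assms(1,2)], of i j k l] assms by simp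
  thus ?thesis by (simp add: sgn_vec_skew[of n j i] ga_inner_linear)
qed

lemma gram_same:
  assumes "i \<noteq> j"
  shows "ga_inner n (sgn_vec n i j) (sgn_vec n i j) = fact n"
proof -
  have "ga_inner n (sgn_vec n i j) (sgn_vec n i j) = (\<Sum>\<sigma>\<in>Sym n. 1)"
    unfolding ga_inner_def
  proof (intro sum.cong refl)
    fix \<sigma> assume \<sigma>: "\<sigma> \<in> Sym n"
    have "\<sigma> i \<noteq> \<sigma> j" using assms by (simp add: inj_Sym[OF \<sigma>])
    thus "cnj (sgn_vec n i j \<sigma>) * sgn_vec n i j \<sigma> = 1"
      by (auto simp: sgn_vec_apply \<sigma> cmp_def)
  qed
  thus ?thesis by (simp add: card_Sym)
qed

abbreviation delta :: "nat \<Rightarrow> nat \<Rightarrow> complex" where "delta i j \<equiv> of_bool (i = j)"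

text \<open>On skew-symmetric matrices the last bracket is the kernel of the identity, and the four
  single deltas are the kernel of n times the projection onto the matrices with entries
  \<open>x i - x j\<close>.\<close>

lemma gram_sgn_vec:
  assumes "i \<in> {1..n}" "j \<in> {1..n}" "k \<in> {1..n}" "l \<in> {1..n}"
  shows "ga_inner n (sgn_vec n i j) (sgn_vec n k l) = fact n / 3 *
    (delta i k - delta i l - delta j k + delta j l + (delta i k * delta j l - delta i l * delta j k))"
proof -
  \<comment> \<open>Skewness brings every pair of vectors with a common index to this shape, where
    the common index comes first in both.\<close>
  have ik: "ga_inner n (sgn_vec n i j) (sgn_vec n i l) = fact n / 3 * (1 - delta i l - delta j i + delta j l + (delta j l - delta i l * delta j i))"
    if "i \<in> {1..n}" "j \<in> {1..n}" "l \<in> {1..n}" for i j l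
    using that gram_shared[of i n j l] gram_same[of i j n]
    by (cases "i = j"; cases "i = l"; cases "j = l") (auto simp: ga_inner_linear)
  consider "i = k" | "i = l" | "j = k" | "j = l" | "k \<noteq> i" "k \<noteq> j" "l \<noteq> i" "l \<noteq> j" by blast
  thus ?thesis
  proof cases
    case 1
    thus ?thesis using ik[of k j l] assms by simp
  next
    case 2
    have "ga_inner n (sgn_vec n i j) (sgn_vec n k l) = - ga_inner n (sgn_vec n l j) (sgn_vec n l k)"
      by (simp add: 2 sgn_vec_skew[of n k l] ga_inner_linear)
    thus ?thesis using ik[of l j k] assms by (simp add: 2 algebra_simps)
  next
    case 3
    have "ga_inner n (sgn_vec n i j) (sgn_vec n k l) = - ga_inner n (sgn_vec n k i) (sgn_vec n k l)"
      by (simp add: 3 sgn_vec_skew[of n i k] ga_inner_linear)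
    thus ?thesis using ik[of k i l] assms by (simp add: 3 algebra_simps)
  next
    case 4
    have "ga_inner n (sgn_vec n i j) (sgn_vec n k l) = ga_inner n (sgn_vec n l i) (sgn_vec n l k)"
      by (simp add: 4 sgn_vec_skew[of n i l] sgn_vec_skew[of n k l] ga_inner_linear)
    thus ?thesis using ik[of l i k] assms by (simp add: 4 algebra_simps)
  next
    case 5
    thus ?thesis using gram_disjoint[OF assms(1,2) 5] by auto
  qed
qed

lemma sum_delta:
  "i \<in> {1..n} \<Longrightarrow> (\<Sum>j\<in>{1..n}. delta i j) = 1" "i \<in> {1..n} \<Longrightarrow> (\<Sum>j\<in>{1..n}. delta j i) = 1"
  by (simp_all add: of_bool_def)

text \<open>In the factor n + 1, the n comes from the terms constant in the summation index and the
  1 from the products of two deltas.\<close>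

lemma gram_rank_sgn:
  assumes "i \<in> {1..n}" "k \<in> {1..n}" "l \<in> {1..n}"
  shows "ga_inner n (rank_vec n i) (sgn_vec n k l) = fact n / 3 * (of_nat n + 1) * (delta i k - delta i l)"
proof -
  have "ga_inner n (rank_vec n i) (sgn_vec n k l) = (\<Sum>j\<in>{1..n}. fact n / 3 *
    (delta i k - delta i l - delta j k + delta j l + (delta i k * delta j l - delta i l * delta j k)))"
    unfolding rank_vec_def ga_inner_linear using assms by (intro sum.cong refl gram_sgn_vec)
  also have "\<dots> = fact n / 3 * (of_nat n + 1) * (delta i k - delta i l)"
    using assms
    by (simp only: sum_distrib_left[symmetric] sum.distrib sum_subtractf sum_delta sum_constant card_atLeastAtMost)
      (simp add: algebra_simps)
  finally show ?thesis .
qed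

lemma gram_rank_rank:
  assumes "i \<in> {1..n}" "k \<in> {1..n}"
  shows "ga_inner n (rank_vec n i) (rank_vec n k) = fact n / 3 * (of_nat n + 1) * (of_nat n * delta i k - 1)"
proof -
  have "ga_inner n (rank_vec n i) (rank_vec n k) =
      (\<Sum>l\<in>{1..n}. fact n / 3 * (of_nat n + 1) * (delta i k - delta i l))"
    unfolding rank_vec_def[of n k] ga_inner_linear using assms by (intro sum.cong refl gram_rank_sgn)
  also have "\<dots> = fact n / 3 * (of_nat n + 1) * (of_nat n * delta i k - 1)"
    using assms
    by (simp only: sum_distrib_left[symmetric] sum.distrib sum_subtractf sum_delta sum_constant card_atLeastAtMost)
      simp
  finally show ?thesis .
qed

lemma ga_inner_cnj: "ga_inner n y x = cnj (ga_inner n x y)"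
  by (simp add: ga_inner_def mult.commute)

lemma gram_sgn_rank:
  assumes "i \<in> {1..n}" "k \<in> {1..n}" "l \<in> {1..n}"
  shows "ga_inner n (sgn_vec n k l) (rank_vec n i) = fact n / 3 * (of_nat n + 1) * (delta k i - delta l i)"
  by (subst ga_inner_cnj)
    (simp add: gram_rank_sgn assms eq_commute[of i k] eq_commute[of i l] del: atLeastAtMost_iff)

text \<open>The rank part contributes a multiple of \<open>D\<close>, the hook part one of
  \<open>N * W - D\<close>. The factor \<open>b\<close> is the one for which the \<open>D\<close>
  terms cancel, and \<open>a\<close> normalises what is left to \<open>W\<close>, the Kronecker
  delta on pairs with \<open>i < j\<close> and \<open>k < l\<close>.\<close>

theorem onb_orthonormal:
  assumes "i \<in> {1..n}" "j \<in> {1..n}" "k \<in> {1..n}" "l \<in> {1..n}"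
  shows "ga_inner n (onb n i j) (onb n k l) = delta i k * delta j l - delta i l * delta j k"
proof -
  define N where "N = (of_nat n :: complex)"
  define f where "f = (fact n :: complex)"
  define D W where "D = delta i k - delta i l - delta j k + delta j l"
    and "W = delta i k * delta j l - delta i l * delta j k"
  define a where "a = (of_real (sqrt 3 / (sqrt (fact n) * real n)) :: complex)"
  define b where "b = (of_real (1 / sqrt (real n + 1)) :: complex)"
  let ?P = "\<lambda>i j. rank_vec n i - rank_vec n j"
  have n: "real n > 0" using assms by auto
  have "a * a = of_real ((sqrt 3 / (sqrt (fact n) * real n)) * (sqrt 3 / (sqrt (fact n) * real n)))"
    by (simp only: a_def of_real_mult)
  also have "(sqrt 3 / (sqrt (fact n) * real n)) * (sqrt 3 / (sqrt (fact n) * real n)) = 3 / (fact n * real n * real n)"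
    by simp
  finally have aa: "a * a = 3 / (f * N * N)" by (simp add: f_def N_def)
  have "b * b = of_real ((1 / sqrt (real n + 1)) * (1 / sqrt (real n + 1)))"
    by (simp only: b_def of_real_mult)
  also have "(1 / sqrt (real n + 1)) * (1 / sqrt (real n + 1)) = 1 / (real n + 1)"
    by simp
  finally have bb: "b * b = 1 / (N + 1)" by (simp add: N_def)
  have "complex_of_real (real n + 1) \<noteq> 0" using n by (simp only: of_real_eq_0_iff)
  hence nz: "N \<noteq> 0" "f \<noteq> 0" "N + 1 \<noteq> 0" using n by (auto simp: N_def f_def)
  have PP: "ga_inner n (?P i j) (?P k l) = f / 3 * (N + 1) * N * D"
  proof -
    have "c * (N + 1) * (N * x - 1) - c * (N + 1) * (N * y - 1) -
      (c * (N + 1) * (N * z - 1) - c * (N + 1) * (N * w - 1)) = c * (N + 1) * N * (x - z - y + w)"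
      for c x y z w by (simp add: algebra_simps)
    thus ?thesis
      unfolding ga_inner_linear(2) unfolding ga_inner_linear(8) D_def
      by (simp only: gram_rank_rank[OF assms(1,3)] gram_rank_rank[OF assms(1,4)]
          gram_rank_rank[OF assms(2,3)] gram_rank_rank[OF assms(2,4)] N_def f_def)
  qed
  have PU: "ga_inner n (?P i j) (sgn_vec n k l) = f / 3 * (N + 1) * D"
  proof -
    have "c * (N + 1) * (x - y) - c * (N + 1) * (z - w) = c * (N + 1) * (x - y - z + w)"
      for c x y z w by (simp add: algebra_simps)
    thus ?thesis
      unfolding ga_inner_linear(8) D_def
      by (simp only: gram_rank_sgn[OF assms(1,3,4)] gram_rank_sgn[OF assms(2,3,4)] N_def f_def)
  qed
  have UP: "ga_inner n (sgn_vec n i j) (?P k l) = f / 3 * (N + 1) * D"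
  proof -
    have "c * (N + 1) * (x - y) - c * (N + 1) * (z - w) = c * (N + 1) * (x - z - y + w)"
      for c x y z w by (simp add: algebra_simps)
    thus ?thesis
      unfolding ga_inner_linear(2) D_def
      by (simp only: gram_sgn_rank[OF assms(3,1,2)] gram_sgn_rank[OF assms(4,1,2)] N_def f_def)
  qed
  have UU: "ga_inner n (sgn_vec n i j) (sgn_vec n k l) = f / 3 * (D + W)"
    by (simp only: gram_sgn_vec[OF assms] f_def D_def W_def)
  \<comment> \<open>Orthogonality of the two components is read off from \<open>PP\<close> being n
    times \<open>PU\<close>.\<close>
  have PG: "ga_inner n (?P i j) (hook_vec n k l) = 0"
    unfolding hook_vec_def ga_inner_linear(2)[of n _ "ga_scale _ _"] ga_inner_linear(4) PP PU
    by (simp add: N_def algebra_simps)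
  have GP: "ga_inner n (hook_vec n i j) (?P k l) = 0"
    unfolding hook_vec_def ga_inner_linear(8)[of n "ga_scale _ _"] ga_inner_linear(10) PP UP
    by (simp add: N_def algebra_simps)
  have GU: "ga_inner n (hook_vec n i j) (sgn_vec n k l) = f / 3 * (N * W - D)"
    unfolding hook_vec_def ga_inner_linear(8)[of n "ga_scale _ _"] ga_inner_linear(10) PU UU
    by (simp add: N_def field_simps)
  have GG: "ga_inner n (hook_vec n i j) (hook_vec n k l) = f / 3 * N * (N * W - D)"
    unfolding hook_vec_def[of n k l] ga_inner_linear(2)[of n _ "ga_scale _ _"] ga_inner_linear(4) GP GU
    by (simp add: N_def)
  have cnj: "cnj a = a" "cnj b = b" by (simp_all add: a_def b_def)
  have onb: "onb n i j = ga_scale a (ga_scale b (?P i j) + hook_vec n i j)"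
    "onb n k l = ga_scale a (ga_scale b (?P k l) + hook_vec n k l)"
    using assms by (simp_all add: onb_def a_def b_def)
  have "ga_inner n (onb n i j) (onb n k l) = (a * a) * ((b * b) * (f / 3 * (N + 1) * N * D) + f / 3 * N * (N * W - D))"
    unfolding onb ga_inner_linear(1,4,7,10) PP PG GP GG cnj by (simp add: algebra_simps)
  also have "\<dots> = W"
  proof -
    have "1 / (N + 1) * (f / 3 * (N + 1) * N * D) = f / 3 * N * D" using nz by simp
    thus ?thesis unfolding aa bb using nz by (simp add: field_simps)
  qed
  finally show ?thesis by (simp add: W_def)
qed

lemma ga_of_mult_rank_vec:
  assumes "\<pi> \<in> Sym n"
  shows "ga_mult n (ga_of \<pi>) (rank_vec n i) = rank_vec n (inv \<pi> i)"
  using sum_Sym_image[OF inv_in_Sym[OF assms], of "\<lambda>k. sgn_vec n (inv \<pi> i) k"]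
  by (simp add: rank_vec_def ga_mult_sum_right ga_of_mult_sgn_vec assms)

lemma ga_of_mult_onb:
  assumes "\<pi> \<in> Sym n"
  shows "ga_mult n (ga_of \<pi>) (onb n i j) = onb n (inv \<pi> i) (inv \<pi> j)"
  using assms
  by (simp add: onb_def hook_vec_def ga_mult_linear ga_of_mult_rank_vec ga_of_mult_sgn_vec del: atLeastAtMost_iff)

lemma onb_skew: "onb n j i = - onb n i j"
  by (auto simp: onb_def hook_vec_def sgn_vec_skew[of n j i] fun_eq_iff algebra_simps)

lemma onb_outside: "i \<notin> {1..n} \<or> j \<notin> {1..n} \<Longrightarrow> onb n i j = 0"
  by (auto simp: onb_def)

lemma onb_closed [simp]: "onb n i j \<in> group_algebra n"
  by (simp add: onb_def)

subsection \<open>The span of the sign vectors\<close>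

lemma H_subspace: "ga.subspace (H n)"
  unfolding H_def by (rule ga.subspace_span)

lemmas H_closed = ga.subspace_0[OF H_subspace] ga.subspace_add[OF H_subspace]
  ga.subspace_diff[OF H_subspace] ga.subspace_scale[OF H_subspace]
  ga.subspace_sum[OF H_subspace] ga.subspace_neg[OF H_subspace]

lemma sgn_vec_in_H:
  assumes "i \<in> {1..n}" "j \<in> {1..n}"
  shows "sgn_vec n i j \<in> H n"
proof -
  have *: "sgn_vec n i j \<in> H n" if "1 \<le> i" "i < j" "j \<le> n" for i j
  proof -
    have "e n i j \<in> H n" unfolding H_def using that by (intro ga.span_base) blast
    hence "ga_scale (of_real (sqrt (fact n))) (e n i j) \<in> H n" by (rule H_closed)
    thus ?thesis using that by (simp add: e_eq_sgn_vec)
  qed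
  consider "i < j" | "i = j" | "j < i" by linarith
  thus ?thesis
  proof cases
    case 3
    thus ?thesis using *[of j i] H_closed(6)[of "sgn_vec n j i"] assms by (simp add: sgn_vec_skew[of n i j])
  qed (use * assms H_closed(1) in auto)
qed

lemma rank_vec_in_H: "i \<in> {1..n} \<Longrightarrow> rank_vec n i \<in> H n"
  unfolding rank_vec_def by (intro H_closed sgn_vec_in_H)

lemma onb_in_H: "onb n i j \<in> H n"
  unfolding onb_def hook_vec_def by (auto intro!: H_closed rank_vec_in_H sgn_vec_in_H)

text \<open>A permutation takes each value once, and the ranks \<open>n + 1 - 2 k\<close> add up to
  0.\<close>

lemma sum_rank_vec: "(\<Sum>k\<in>{1..n}. rank_vec n k) = 0"
proof (rule group_algebra_eqI[of _ n])
  fix \<sigma> assume \<sigma>: "\<sigma> \<in> Sym n"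
  have "(\<Sum>k\<in>{1..n}. rank_vec n k \<sigma>) = (\<Sum>k\<in>{1..n}. of_nat n + 1 - 2 * of_nat (\<sigma> k))"
    using \<sigma> by (intro sum.cong refl rank_vec_apply)
  also have "\<dots> = 0"
    by (subst sum_Sym_image[OF \<sigma>, of "\<lambda>k. of_nat n + 1 - 2 * of_nat k"]) (rule sum_linear_nat)
  finally show "(\<Sum>k\<in>{1..n}. rank_vec n k) \<sigma> = 0 \<sigma>" by (simp add: sum_fun_apply)
qed simp_all

text \<open>The rescaling of the components is undone explicitly: the rank vectors are recovered
  from sums of the \<open>onb\<close>, and the sign vectors from both.\<close>

lemma H_eq_span_onb:
  assumes "n \<ge> 1"
  shows "H n = ga.span {onb n i j | i j. 1 \<le> i \<and> i < j \<and> j \<le> n}"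
proof -
  let ?S = "ga.span {onb n i j | i j. 1 \<le> i \<and> i < j \<and> j \<le> n}"
  note cl = ga.span_zero ga.span_add ga.span_diff ga.span_scale ga.span_sum
  have onb: "onb n i j \<in> ?S" for i j
  proof -
    have *: "onb n i j \<in> ?S" if "i \<in> {1..n}" "j \<in> {1..n}" "i < j" for i j
      using that by (intro ga.span_base) auto
    consider "i \<notin> {1..n} \<or> j \<notin> {1..n}" | "i = j" | "i \<in> {1..n}" "j \<in> {1..n}" "i < j"
      | "i \<in> {1..n}" "j \<in> {1..n}" "j < i"
      using nat_neq_iff[of i j] by blast
    thus ?thesis
    proof cases
      case 1
      thus ?thesis by (simp add: onb_outside ga.span_zero)
    next
      case 2
      thus ?thesis by (simp add: onb_def hook_vec_def ga.span_zero)
    next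
      case 3
      thus ?thesis by (rule *)
    next
      case 4
      thus ?thesis using *[of j i] ga.span_neg by (simp add: onb_skew[of n i j])
    qed
  qed
  define a where "a = (of_real (sqrt 3 / (sqrt (fact n) * real n)) :: complex)"
  define b where "b = (of_real (1 / sqrt (real n + 1)) :: complex)"
  have "real n + 1 \<noteq> 0" by linarith
  hence nz: "a \<noteq> 0" "b \<noteq> 0" "(of_nat n :: complex) \<noteq> 0" using assms by (auto simp: a_def b_def)
  have onb_eq: "onb n i j = ga_scale a (ga_scale b (rank_vec n i - rank_vec n j) + hook_vec n i j)"
    if "i \<in> {1..n}" "j \<in> {1..n}" for i j using that by (simp add: onb_def a_def b_def)
  have rank: "rank_vec n i \<in> ?S" if i: "i \<in> {1..n}" for i
  proof -
    have const: "(\<Sum>k\<in>{1..n}. x) = ga_scale (of_nat n) x" for x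
      by (simp add: fun_eq_iff sum_fun_apply)
    \<comment> \<open>Summation over \<open>k\<close> removes the hook parts and the
      \<open>rank_vec n k\<close>, leaving a nonzero multiple of
      \<open>rank_vec n i\<close>.\<close>
    have "(\<Sum>k\<in>{1..n}. onb n i k) = (\<Sum>k\<in>{1..n}. ga_scale a (ga_scale b (rank_vec n i - rank_vec n k) + hook_vec n i k))"
      using i by (intro sum.cong refl onb_eq)
    also have "\<dots> = ga_scale a (ga_scale b (ga_scale (of_nat n) (rank_vec n i)))"
      unfolding ga.scale_sum_right[symmetric] sum.distrib sum_subtractf hook_vec_def sum_rank_vec const
        rank_vec_def[of n i, symmetric] by simp
    finally have eq: "rank_vec n i = ga_scale (1 / (a * b * of_nat n)) (\<Sum>k\<in>{1..n}. onb n i k)"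
      using nz by simp
    show ?thesis unfolding eq by (intro cl onb)
  qed
  have "sgn_vec n i j \<in> ?S" if ij: "i \<in> {1..n}" "j \<in> {1..n}" for i j
  proof -
    have eq: "sgn_vec n i j = ga_scale (1 / of_nat n) (rank_vec n i - rank_vec n j +
       (ga_scale (1 / a) (onb n i j) - ga_scale b (rank_vec n i - rank_vec n j)))"
      unfolding onb_eq[OF ij] using nz by (simp add: hook_vec_def)
    show ?thesis unfolding eq by (intro cl rank ij onb)
  qed
  hence "e n i j \<in> ?S" if "1 \<le> i" "i < j" "j \<le> n" for i j
    using that by (simp add: e_eq_sgn_vec cl)
  hence "H n \<subseteq> ?S" unfolding H_def by (intro ga.span_minimal) auto
  moreover have "?S \<subseteq> H n" by (intro ga.span_minimal H_subspace) (auto intro: onb_in_H)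
  ultimately show ?thesis by blast
qed

lemma H_induct [consumes 2, case_names subspace base]:
  assumes "n \<ge> 1" "x \<in> H n" "ga.subspace {x. P x}"
    and "\<And>i j. 1 \<le> i \<Longrightarrow> i < j \<Longrightarrow> j \<le> n \<Longrightarrow> P (onb n i j)"
  shows "P x"
  using assms(2) unfolding H_eq_span_onb[OF assms(1)]
  by (rule ga.span_induct[OF _ assms(3)]) (use assms(4) in auto)

lemma H_subset_group_algebra: "H n \<subseteq> group_algebra n"
  unfolding H_def
  by (intro ga.span_minimal group_algebra_subspace) (auto simp: e_eq_sgn_vec)

lemma left_regular_in_H:
  assumes "n \<ge> 1" "x \<in> H n" "\<sigma> \<in> Sym n"
  shows "left_regular n \<sigma> x \<in> H n"
  using assms(1,2)
proof (induction rule: H_induct)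
  case subspace
  show ?case
    by (auto simp: ga.subspace_def left_regular_def ga_mult_linear intro: H_closed)
next
  case (base i j)
  show ?case using assms(3) by (simp add: left_regular_def ga_of_mult_onb onb_in_H)
qed

subsection \<open>The operator\<close>

definition coord :: "nat \<Rightarrow> ga \<Rightarrow> cmat" where
  "coord n x = (\<lambda>i j. ga_inner n (onb n i j) x)"

lemma coord_in_M: "coord n x \<in> M n"
proof -
  have "coord n x j i = - coord n x i j" for i j
    by (simp add: coord_def onb_skew[of n j i] ga_inner_linear)
  moreover have "coord n x i j = 0" if "i \<notin> {1..n} \<or> j \<notin> {1..n}" for i j
    by (simp add: coord_def onb_outside[OF that] ga_inner_linear)
  ultimately show ?thesis unfolding M_def by blast
qed

lemma coord_linear:
  "coord n (x + y) = coord n x + coord n y" "coord n (ga_scale c x) = mat_scale c (coord n x)"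
  "coord n 0 = 0"
  by (simp_all add: coord_def fun_eq_iff ga_inner_linear mat_scale_def)

lemma coord_onb:
  assumes "1 \<le> k" "k < l" "l \<le> n"
  shows "coord n (onb n k l) = E k l"
proof (intro ext)
  fix i j
  show "coord n (onb n k l) i j = E k l i j"
  proof (cases "i \<in> {1..n} \<and> j \<in> {1..n}")
    case True
    thus ?thesis using assms by (auto simp: coord_def onb_orthonormal E_def)
  next
    case False
    hence "coord n (onb n k l) i j = 0" by (simp only: coord_def onb_outside ga_inner_linear de_Morgan_conj)
    thus ?thesis using assms False by (auto simp: E_def)
  qed
qed

abbreviation upper :: "nat \<Rightarrow> (nat \<times> nat) set" where
  "upper n \<equiv> {(i, j). 1 \<le> i \<and> i < j \<and> j \<le> n}"

lemma finite_upper [simp]: "finite (upper n)"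
  by (rule finite_subset[of _ "{1..n} \<times> {1..n}"]) auto

lemma E_upper:
  assumes "(i, j) \<in> upper n" "(k, l) \<in> upper n"
  shows "E k l i j = of_bool ((i, j) = (k, l))"
  using assms by (auto simp: E_def)

text \<open>Both sides are linear in \<open>x\<close>, so it suffices to compare them on the
  spanning vectors, where orthonormality leaves one term.\<close>

lemma H_expand:
  assumes "n \<ge> 1" "x \<in> H n"
  shows "x = (\<Sum>(k, l)\<in>upper n. ga_scale (coord n x k l) (onb n k l))"
  using assms
proof (induction rule: H_induct)
  case subspace
  define F where "F x = (\<Sum>(k, l)\<in>upper n. ga_scale (coord n x k l) (onb n k l))" for x
  have "F 0 = 0" "F (x + y) = F x + F y" "F (ga_scale c x) = ga_scale c (F x)" for x y c
    by (simp_all add: F_def coord_linear mat_scale_def ga.scale_left_distrib sum.distrib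
        ga.scale_sum_right split_def)
  hence "ga.subspace {x. x = F x}"
    unfolding ga.subspace_def by simp
  thus ?case by (simp only: F_def)
next
  case (base i j)
  have "(\<Sum>(k, l)\<in>upper n. ga_scale (coord n (onb n i j) k l) (onb n k l)) =
      (\<Sum>(k, l)\<in>upper n. if (k, l) = (i, j) then onb n k l else 0)"
    using base by (intro sum.cong refl) (auto simp: coord_onb E_def)
  also have "\<dots> = (\<Sum>p\<in>upper n. if p = (i, j) then onb n i j else 0)"
    by (intro sum.cong refl) auto
  also have "\<dots> = onb n i j" using base by simp
  finally show ?case by (rule sym)
qed

text \<open>Parseval: \<open>x\<close> is expanded, and its coefficients leave the conjugate-linear
  argument conjugated, as \<open>mat_inner\<close> requires.\<close>

lemma coord_isometry:
  assumes "n \<ge> 1" "x \<in> H n"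
  shows "mat_inner n (coord n x) (coord n y) = ga_inner n x y"
proof -
  have "ga_inner n x y = ga_inner n (\<Sum>(k, l)\<in>upper n. ga_scale (coord n x k l) (onb n k l)) y"
    using H_expand[OF assms] by simp
  also have "\<dots> = mat_inner n (coord n x) (coord n y)"
    unfolding mat_inner_def ga_inner_linear
    by (intro sum.cong refl) (auto simp: ga_inner_linear coord_def)
  finally show ?thesis by simp
qed

section \<open>The matrix side and the bijection onto it\<close>

lemma M_I:
  assumes "\<And>i j. a j i = - a i j" "\<And>i j. i \<notin> {1..n} \<or> j \<notin> {1..n} \<Longrightarrow> a i j = 0"
  shows "a \<in> M n"
  using assms unfolding M_def by blast

lemma M_D:
  assumes "a \<in> M n"
  shows "a j i = - a i j" "i \<notin> {1..n} \<or> j \<notin> {1..n} \<Longrightarrow> a i j = 0"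
  using assms unfolding M_def by blast+

lemma M_subspace: "cmat.subspace (M n)"
  unfolding cmat.subspace_def
proof (intro conjI ballI allI)
  show "0 \<in> M n" by (rule M_I) auto
  fix a b c assume a: "a \<in> M n" and b: "b \<in> M n"
  show "a + b \<in> M n"
  proof (rule M_I)
    show "(a + b) j i = - (a + b) i j" for i j
      by (simp add: M_D(1)[OF a, of j i] M_D(1)[OF b, of j i])
  qed (simp only: plus_fun_apply M_D(2)[OF a] M_D(2)[OF b], simp)
next
  fix a c assume a: "a \<in> M n"
  show "mat_scale c a \<in> M n"
  proof (rule M_I)
    show "mat_scale c a j i = - mat_scale c a i j" for i j
      by (simp add: mat_scale_def M_D(1)[OF a, of j i])
  qed (simp only: mat_scale_def M_D(2)[OF a], simp)
qed

lemma M_eqI: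
  assumes "a \<in> M n" "b \<in> M n" "\<And>i j. (i, j) \<in> upper n \<Longrightarrow> a i j = b i j"
  shows "a = b"
proof (intro ext)
  fix i j
  have skew: "a i j = - a j i" "b i j = - b j i" for i j using M_D(1) assms(1,2) by blast+
  have "(i \<notin> {1..n} \<or> j \<notin> {1..n}) \<or> (i, j) \<in> upper n \<or> (j, i) \<in> upper n \<or> i = j" by auto
  then consider "i \<notin> {1..n} \<or> j \<notin> {1..n}" | "(i, j) \<in> upper n" | "(j, i) \<in> upper n" | "i = j"
    by blast
  thus "a i j = b i j"
  proof cases
    case 1
    thus ?thesis using assms(1,2) by (simp only: M_D(2))
  next
    case 4
    thus ?thesis using skew[of i i] by simp
  qed (use assms(3) skew[of i j] in auto)
qed

lemma coord_bij:
  assumes "n \<ge> 1"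
  shows "bij_betw (coord n) (H n) (M n)"
proof (intro bij_betw_imageI)
  show "inj_on (coord n) (H n)"
  proof (rule inj_onI)
    fix x y assume x: "x \<in> H n" and y: "y \<in> H n" and eq: "coord n x = coord n y"
    note H_expand[OF assms x]
    also have "(\<Sum>(k, l)\<in>upper n. ga_scale (coord n x k l) (onb n k l)) = y"
      unfolding eq by (rule H_expand[OF assms y, symmetric])
    finally show "x = y" .
  qed
  show "coord n ` H n = M n"
  proof (intro equalityI subsetI)
    fix a assume a: "a \<in> M n"
    define x where "x = (\<Sum>(k, l)\<in>upper n. ga_scale (a k l) (onb n k l))"
    have "x \<in> H n" unfolding x_def by (auto intro!: H_closed onb_in_H)
    moreover have "coord n x = a"
    proof (rule M_eqI[OF coord_in_M a])
      fix i j assume ij: "(i, j) \<in> upper n"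
      have "coord n x i j = (\<Sum>(k, l)\<in>upper n. a k l * coord n (onb n k l) i j)"
        unfolding coord_def x_def ga_inner_linear
        by (intro sum.cong refl) (auto simp: ga_inner_linear)
      also have "\<dots> = (\<Sum>p\<in>upper n. if p = (i, j) then a i j else 0)"
      proof (intro sum.cong refl)
        fix p assume p: "p \<in> upper n"
        obtain k l where kl: "p = (k, l)" by (cases p)
        have "coord n (onb n k l) i j = of_bool ((i, j) = (k, l))"
          using p kl E_upper[OF ij, of k l] by (simp add: coord_onb)
        thus "(case p of (k, l) \<Rightarrow> a k l * coord n (onb n k l) i j) = (if p = (i, j) then a i j else 0)"
          by (auto simp: kl)
      qed
      also have "\<dots> = a i j" using ij by (subst sum.delta) simp_all
      finally show "coord n x i j = a i j" .
    qed
    ultimately show "a \<in> coord n ` H n" by blast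
  qed (auto intro: coord_in_M)
qed

text \<open>The vector paired at \<open>i\<close>, \<open>j\<close> is the translate by
  \<open>\<sigma>\<close> of the one at \<open>\<sigma> i\<close>, \<open>\<sigma> j\<close>, and
  left multiplication by \<open>\<sigma>\<close> preserves the inner product.\<close>

lemma coord_equivariant:
  assumes "\<sigma> \<in> Sym n"
  shows "coord n (left_regular n \<sigma> x) = rho \<sigma> (coord n x)"
proof (intro ext)
  fix i j
  have "onb n i j = ga_mult n (ga_of \<sigma>) (onb n (\<sigma> i) (\<sigma> j))"
    using assms by (simp add: ga_of_mult_onb)
  thus "coord n (left_regular n \<sigma> x) i j = rho \<sigma> (coord n x) i j"
    using ga_inner_left_mult[OF assms] by (simp add: coord_def left_regular_def rho_def)
qed

section \<open>The two representations and the uniqueness of the operator\<close>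

lemma representation_H:
  assumes "n \<ge> 1"
  shows "representation n ga_scale (H n) (left_regular n)"
  unfolding representation_def
proof (intro conjI ballI)
  show "vector_space ga_scale" by (rule ga.vector_space_axioms)
  show "ga.subspace (H n)" by (rule H_subspace)
  show "linear_between ga_scale (H n) ga_scale (H n) (left_regular n \<sigma>)" if "\<sigma> \<in> Sym n" for \<sigma>
    using left_regular_in_H[OF assms _ that]
    by (auto simp: linear_between_def left_regular_def ga_mult_linear)
  show "left_regular n id x = x" if "x \<in> H n" for x
    using subsetD[OF H_subset_group_algebra that] by (simp add: left_regular_def)
  show "left_regular n (perm_mult \<sigma> \<tau>) x = left_regular n \<sigma> (left_regular n \<tau> x)"
    if "\<sigma> \<in> Sym n" "\<tau> \<in> Sym n" for \<sigma> \<tau> x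
  proof -
    have "perm_mult \<sigma> \<tau> = \<tau> \<circ> \<sigma>" by (simp add: perm_mult_def o_def)
    thus ?thesis using that by (simp add: left_regular_def ga_mult_assoc flip: ga_of_mult_ga_of)
  qed
qed

lemma representation_M: "representation n mat_scale (M n) rho"
  unfolding representation_def
proof (intro conjI ballI)
  show "vector_space mat_scale" by (rule cmat.vector_space_axioms)
  show "cmat.subspace (M n)" by (rule M_subspace)
  show "linear_between mat_scale (M n) mat_scale (M n) (rho \<sigma>)" if "\<sigma> \<in> Sym n" for \<sigma>
  proof -
    have "rho \<sigma> a \<in> M n" if a: "a \<in> M n" for a
    proof (rule M_I)
      show "rho \<sigma> a j i = - rho \<sigma> a i j" for i j
        by (simp add: rho_def M_D(1)[OF a, of "\<sigma> j" "\<sigma> i"])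
      show "rho \<sigma> a i j = 0" if "i \<notin> {1..n} \<or> j \<notin> {1..n}" for i j
        unfolding rho_def by (rule M_D(2)[OF a]) (simp only: Sym_in_range[OF \<open>\<sigma> \<in> Sym n\<close>] that)
    qed
    thus ?thesis by (auto simp: linear_between_def rho_def mat_scale_def fun_eq_iff)
  qed
qed (simp_all add: rho_def perm_mult_def)

lemma linear_on_H_unique:
  assumes "n \<ge> 1" and T: "linear_between ga_scale (H n) mat_scale (M n) T"
    and onb: "\<And>i j. 1 \<le> i \<Longrightarrow> i < j \<Longrightarrow> j \<le> n \<Longrightarrow> T (onb n i j) = E i j"
    and "x \<in> H n"
  shows "T x = coord n x"
proof -
  have add: "T (x + y) = T x + T y" and scale: "T (ga_scale c x) = mat_scale c (T x)"
    if "x \<in> H n" "y \<in> H n" for x y c using T that by (auto simp: linear_between_def)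
  have zero: "T 0 = 0" using scale[OF H_closed(1) H_closed(1), of 0] by simp
  \<comment> \<open>Membership is carried through the induction because \<open>T\<close> is known to
    be additive only on \<open>H n\<close>.\<close>
  have "x \<in> H n \<and> T x = coord n x"
    using assms(1,4)
  proof (induction rule: H_induct)
    case subspace
    show ?case
      by (auto simp: ga.subspace_def zero add scale coord_linear intro: H_closed)
  next
    case (base i j)
    thus ?case by (simp add: onb onb_in_H coord_onb)
  qed
  thus ?thesis ..
qed

lemma coord_unitary_rep_iso:
  assumes n: "n \<ge> 1" and T: "\<And>x. x \<in> H n \<Longrightarrow> T x = coord n x"
  shows "unitary_rep_iso n ga_scale (H n) (ga_inner n) (left_regular n) mat_scale (M n) (mat_inner n) rho T"
  unfolding unitary_rep_iso_def
proof (intro conjI ballI)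
  show "representation n ga_scale (H n) (left_regular n)" by (rule representation_H[OF n])
  show "representation n mat_scale (M n) rho" by (rule representation_M)
  show "linear_between ga_scale (H n) mat_scale (M n) T"
    unfolding linear_between_def using T by (auto simp: H_closed coord_linear coord_in_M)
  show "bij_betw T (H n) (M n)"
    using coord_bij[OF n] bij_betw_cong[of "H n" T "coord n" "M n"] T by blast
  show "mat_inner n (T x) (T y) = ga_inner n x y" if "x \<in> H n" "y \<in> H n" for x y
    using that by (simp add: T coord_isometry n)
  show "T (left_regular n \<sigma> x) = rho \<sigma> (T x)" if "\<sigma> \<in> Sym n" "x \<in> H n" for \<sigma> x
    using that by (simp add: T coord_equivariant left_regular_in_H n)
qed

theorem theorem1:
  fixes n :: nat
  assumes "n \<ge> 3"
  shows "(\<forall>i j. 1 \<le> i \<and> i < j \<and> j \<le> n \<longrightarrow> e' n i j \<in> H n) \<and>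
    (\<exists>!T. T \<in> extensional (H n) \<and> linear_between ga_scale (H n) mat_scale (M n) T \<and>
       (\<forall>i j. 1 \<le> i \<and> i < j \<and> j \<le> n \<longrightarrow> T (e' n i j) = E i j)) \<and>
    (\<forall>T. linear_between ga_scale (H n) mat_scale (M n) T \<and>
       (\<forall>i j. 1 \<le> i \<and> i < j \<and> j \<le> n \<longrightarrow> T (e' n i j) = E i j) \<longrightarrow>
       unitary_rep_iso n ga_scale (H n) (ga_inner n) (left_regular n)
                         mat_scale (M n) (mat_inner n) rho T)"
proof (intro conjI)
  have n: "n \<ge> 1" using assms by simp
  have e': "e' n i j = onb n i j" if "1 \<le> i \<and> i < j \<and> j \<le> n" for i j
    using that by (intro e'_eq_onb[OF assms]) auto
  have unique: "T x = coord n x"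
    if "linear_between ga_scale (H n) mat_scale (M n) T \<and>
      (\<forall>i j. 1 \<le> i \<and> i < j \<and> j \<le> n \<longrightarrow> T (e' n i j) = E i j)" "x \<in> H n" for T x
    using that e' by (intro linear_on_H_unique[OF n]) auto
  show "\<forall>i j. 1 \<le> i \<and> i < j \<and> j \<le> n \<longrightarrow> e' n i j \<in> H n"
    by (simp add: e' onb_in_H)
  show "\<forall>T. linear_between ga_scale (H n) mat_scale (M n) T \<and>
       (\<forall>i j. 1 \<le> i \<and> i < j \<and> j \<le> n \<longrightarrow> T (e' n i j) = E i j) \<longrightarrow>
       unitary_rep_iso n ga_scale (H n) (ga_inner n) (left_regular n)
                         mat_scale (M n) (mat_inner n) rho T"
    using unique coord_unitary_rep_iso[OF n] by blast
  \<comment> \<open>The values on \<open>H n\<close> are forced; restricting fixes the default value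
    outside, so that the operator is unique as a function.\<close>
  let ?T = "restrict (coord n) (H n)"
  show "\<exists>!T. T \<in> extensional (H n) \<and> linear_between ga_scale (H n) mat_scale (M n) T \<and>
       (\<forall>i j. 1 \<le> i \<and> i < j \<and> j \<le> n \<longrightarrow> T (e' n i j) = E i j)"
  proof (rule ex1I[of _ ?T])
    have "unitary_rep_iso n ga_scale (H n) (ga_inner n) (left_regular n) mat_scale (M n) (mat_inner n) rho ?T"
      by (rule coord_unitary_rep_iso[OF n]) simp
    hence "linear_between ga_scale (H n) mat_scale (M n) ?T" by (simp add: unitary_rep_iso_def)
    thus "?T \<in> extensional (H n) \<and> linear_between ga_scale (H n) mat_scale (M n) ?T \<and>
       (\<forall>i j. 1 \<le> i \<and> i < j \<and> j \<le> n \<longrightarrow> ?T (e' n i j) = E i j)"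
      by (simp add: e' onb_in_H coord_onb)
  next
    fix T assume T: "T \<in> extensional (H n) \<and> linear_between ga_scale (H n) mat_scale (M n) T \<and>
       (\<forall>i j. 1 \<le> i \<and> i < j \<and> j \<le> n \<longrightarrow> T (e' n i j) = E i j)"
    hence "T x = coord n x" if "x \<in> H n" for x using unique that by blast
    thus "T = ?T" using T by (intro extensionalityI[of T "H n" ?T]) auto
  qed
qed

end
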